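(* Let $X$ be a complete Hausdorff locally convex vector space over $\mathbb{C}$ and let $C[a,b]$ be the Banach space of continuous complex functions on $[a,b]$ with the sup norm. Then: (i) if $x(\cdot):[a,b]\to X$ has weakly compact semivariation on $[a,b]$, then $Tg=\int_a^b g(t)\,dx(t)$ defines a weakly compact linear mapping $T:C[a,b]\to X$; (ii) conversely, for every weakly compact linear mapping $T:C[a,b]\to X$ there exists a function $y(\cdot):[a,b]\to X$ with weakly compact semivariation on $[a,b]$ such that $Tg=\int_a^b g(t)\,dy(t)$ for all $g\in C[a,b]$. Thus the weakly compact linear mappings $C[a,b]\to X$ are exactly the mappings of the form $g\mapsto\int_a^b g(t)\,dx(t)$ with $x(\cdot)$ of weakly compact semivariation.
   Context: For $x(\cdot):[a,b]\to X$ let $E(a,b)=\{\sum_{i=1}^n[x(t_{2i})-x(t_{2i-1})] : n\ge1,\ a\le t_1<t_2<\dots<t_{2n}\le b\}$; $x(\cdot)$ has weakly compact semivariation on $[a,b]$ if $E(a,b)$ is relatively weakly compact in $X$. The integral $\int_a^b g\,dx$ is the limit in the topology of $X$, as the mesh $\max_i|t_i-t_{i-1}|\to0$, of the sums $\sum_{i=1}^n g(s_i)[x(t_i)-x(t_{i-1})]$ over tagged divisions $a=t_0\le\dots\le t_n=b$, $s_i\in[t_{i-1},t_i]$. A linear mapping $T$ from a locally convex space $Z$ into a locally convex space $Y$ is weakly compact if there exist a neighbourhood $U$ of zero in $Z$ and a weakly compact set $K\subset Y$ with $T(U)\subset K$. *)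

theory Defs
  imports "HOL-Analysis.Analysis"
begin

definition cvs :: "(complex \<Rightarrow> 'x::ab_group_add \<Rightarrow> 'x) \<Rightarrow> bool" where
  "cvs sm \<longleftrightarrow>
     (\<forall>c x y. sm c (x + y) = sm c x + sm c y) \<and>
     (\<forall>c d x. sm (c + d) x = sm c x + sm d x) \<and>
     (\<forall>c d x. sm c (sm d x) = sm (c * d) x) \<and>
     (\<forall>x. sm 1 x = x)"

definition seminorm :: "(complex \<Rightarrow> 'x::ab_group_add \<Rightarrow> 'x) \<Rightarrow> ('x \<Rightarrow> real) \<Rightarrow> bool" where
  "seminorm sm p \<longleftrightarrow> (\<forall>x y. p (x + y) \<le> p x + p y) \<and> (\<forall>c x. p (sm c x) = cmod c * p x)"

definition lc_top :: "('x::ab_group_add \<Rightarrow> real) set \<Rightarrow> 'x topology" where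
  "lc_top P = topology_generated_by
     (insert UNIV {{y. p (y - x) < e} | p x e. p \<in> P \<and> e > 0})"

definition dual_space :: "(complex \<Rightarrow> 'x::ab_group_add \<Rightarrow> 'x) \<Rightarrow> ('x \<Rightarrow> real) set \<Rightarrow> ('x \<Rightarrow> complex) set" where
  "dual_space sm P = {f. (\<forall>x y. f (x + y) = f x + f y) \<and> (\<forall>c x. f (sm c x) = c * f x)
                        \<and> continuous_map (lc_top P) euclidean f}"

definition weak_top :: "(complex \<Rightarrow> 'x::ab_group_add \<Rightarrow> 'x) \<Rightarrow> ('x \<Rightarrow> real) set \<Rightarrow> 'x topology" where
  "weak_top sm P = topology_generated_by
     (insert UNIV {f -` U | f U. f \<in> dual_space sm P \<and> open U})"

definition cauchy_filter :: "('x::ab_group_add \<Rightarrow> real) set \<Rightarrow> 'x filter \<Rightarrow> bool" where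
  "cauchy_filter P F \<longleftrightarrow> F \<noteq> bot \<and>
     (\<forall>p\<in>P. \<forall>e>0. \<exists>A. eventually (\<lambda>x. x \<in> A) F \<and> (\<forall>x\<in>A. \<forall>y\<in>A. p (x - y) < e))"

definition complete_hausdorff_lcs :: "(complex \<Rightarrow> 'x::ab_group_add \<Rightarrow> 'x) \<Rightarrow> ('x \<Rightarrow> real) set \<Rightarrow> bool" where
  "complete_hausdorff_lcs sm P \<longleftrightarrow>
     cvs sm \<and> (\<forall>p\<in>P. seminorm sm p) \<and>
     (\<forall>x. x \<noteq> 0 \<longrightarrow> (\<exists>p\<in>P. p x \<noteq> 0)) \<and>
     (\<forall>F. cauchy_filter P F \<longrightarrow> (\<exists>l. limitin (lc_top P) id l F))"

definition CAB :: "real \<Rightarrow> real \<Rightarrow> (real \<Rightarrow> complex) set" where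
  "CAB a b = {g. continuous_on {a..b} g \<and> (\<forall>t. t \<notin> {a..b} \<longrightarrow> g t = 0)}"

definition supnorm :: "real \<Rightarrow> real \<Rightarrow> (real \<Rightarrow> complex) \<Rightarrow> real" where
  "supnorm a b g = (SUP t\<in>{a..b}. cmod (g t))"

definition tagged_div :: "real \<Rightarrow> real \<Rightarrow> nat \<Rightarrow> (nat \<Rightarrow> real) \<Rightarrow> (nat \<Rightarrow> real) \<Rightarrow> bool" where
  "tagged_div a b n t s \<longleftrightarrow> t 0 = a \<and> t n = b \<and>
     (\<forall>i<n. t i \<le> t (Suc i) \<and> t i \<le> s (Suc i) \<and> s (Suc i) \<le> t (Suc i))"

definition rs_sum :: "(complex \<Rightarrow> 'x::ab_group_add \<Rightarrow> 'x) \<Rightarrow> (real \<Rightarrow> complex) \<Rightarrow> (real \<Rightarrow> 'x)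
    \<Rightarrow> nat \<Rightarrow> (nat \<Rightarrow> real) \<Rightarrow> (nat \<Rightarrow> real) \<Rightarrow> 'x" where
  "rs_sum sm g x n t s = (\<Sum>i<n. sm (g (s (Suc i))) (x (t (Suc i)) - x (t i)))"

definition has_rs_integral :: "(complex \<Rightarrow> 'x::ab_group_add \<Rightarrow> 'x) \<Rightarrow> ('x \<Rightarrow> real) set
    \<Rightarrow> real \<Rightarrow> real \<Rightarrow> (real \<Rightarrow> complex) \<Rightarrow> (real \<Rightarrow> 'x) \<Rightarrow> 'x \<Rightarrow> bool" where
  "has_rs_integral sm P a b g x I \<longleftrightarrow>
     (\<forall>U. openin (lc_top P) U \<and> I \<in> U \<longrightarrow>
        (\<exists>\<delta>>0. \<forall>n t s. tagged_div a b n t s \<and> (\<forall>i<n. t (Suc i) - t i < \<delta>)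
                  \<longrightarrow> rs_sum sm g x n t s \<in> U))"

text \<open>E(a,b), with points reindexed from 0: a \<le> t 0 < t 1 < ... < t (2n-1) \<le> b.\<close>
definition Eset :: "(real \<Rightarrow> 'x::ab_group_add) \<Rightarrow> real \<Rightarrow> real \<Rightarrow> 'x set" where
  "Eset x a b = {(\<Sum>i<n. x (t (2*i+1)) - x (t (2*i))) | n t.
       n \<ge> 1 \<and> a \<le> t 0 \<and> (\<forall>i<2*n-1. t i < t (Suc i)) \<and> t (2*n-1) \<le> b}"

definition weakly_compact_semivariation :: "(complex \<Rightarrow> 'x::ab_group_add \<Rightarrow> 'x) \<Rightarrow> ('x \<Rightarrow> real) set
    \<Rightarrow> (real \<Rightarrow> 'x) \<Rightarrow> real \<Rightarrow> real \<Rightarrow> bool" where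
  "weakly_compact_semivariation sm P x a b \<longleftrightarrow>
     compactin (weak_top sm P) ((weak_top sm P) closure_of (Eset x a b))"

text \<open>T : C[a,b] \<rightarrow> X linear and weakly compact: some neighbourhood of zero (which we may
  take to be an open ball of C[a,b]) is mapped into a weakly compact set.\<close>
definition weakly_compact_linear :: "(complex \<Rightarrow> 'x::ab_group_add \<Rightarrow> 'x) \<Rightarrow> ('x \<Rightarrow> real) set
    \<Rightarrow> real \<Rightarrow> real \<Rightarrow> ((real \<Rightarrow> complex) \<Rightarrow> 'x) \<Rightarrow> bool" where
  "weakly_compact_linear sm P a b T \<longleftrightarrow>
     (\<forall>g\<in>CAB a b. \<forall>h\<in>CAB a b. T (\<lambda>t. g t + h t) = T g + T h) \<and>
     (\<forall>c. \<forall>g\<in>CAB a b. T (\<lambda>t. c * g t) = sm c (T g)) \<and>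
     (\<exists>r>0. \<exists>K. compactin (weak_top sm P) K \<and>
        T ` {g\<in>CAB a b. supnorm a b g < r} \<subseteq> K)"

end

theory Submission
  imports Defs
begin

text \<open>
  No appeal to Krein's theorem is needed in the first half: if \<open>c\<^sub>k \<in> [0,1]\<close> has binary digits
  \<open>d\<^sub>k\<^sub>i\<close>, then \<open>\<Sum>\<^sub>k c\<^sub>k \<Delta>\<^sub>kx = \<Sum>\<^sub>i 2\<^sup>-\<^sup>i\<^sup>-\<^sup>1 e\<^sub>i\<close>, where \<open>e\<^sub>i\<close> is the sum of the increments \<open>\<Delta>\<^sub>kx\<close> with
  \<open>d\<^sub>k\<^sub>i = 1\<close> and so lies in \<open>E(a,b) \<union> {0}\<close>. Hence all Riemann--Stieltjes sums with
  \<open>[0,1]\<close>-valued integrand lie in the image of a countable power of a weakly compact set under the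
  weakly continuous map \<open>(e\<^sub>i) \<mapsto> \<Sum>\<^sub>i 2\<^sup>-\<^sup>i\<^sup>-\<^sup>1 e\<^sub>i\<close>. Weakly compact sets are bounded, which makes the
  Riemann--Stieltjes sums of a continuous function a Cauchy net.

  For the converse, approximate the indicator functions of \<open>[a,t)\<close> by continuous ramps. By
  Tychonoff's theorem the images of the ramps under \<open>T\<close> have a cluster point \<open>y\<close>, simultaneously in
  all \<open>t\<close>, for the topology of pointwise weak convergence. Finite linear combinations of ramps
  with sup norm at most 1 are mapped into a fixed weakly compact set, and this passes to \<open>y\<close>.
\<close>

section \<open>The Hahn--Banach theorem\<close>

locale complex_space =
  fixes sm :: "complex \<Rightarrow> 'x::ab_group_add \<Rightarrow> 'x"
  assumes cvs: "cvs sm"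

sublocale complex_space \<subseteq> vector_space sm
  using cvs by unfold_locales (simp_all add: cvs_def)

context complex_space
begin

text \<open>Only one inequality of homogeneity is demanded, which is easy to check for infima.
  Applying it to \<open>1/r\<close> as well gives equality in
  \<open>sublinear_scale\<close>.\<close>

definition sublinear :: "('x \<Rightarrow> real) \<Rightarrow> bool" where
  "sublinear q \<longleftrightarrow> q 0 = 0 \<and> (\<forall>x y. q (x + y) \<le> q x + q y) \<and>
     (\<forall>r>0. \<forall>x. q (sm (of_real r) x) \<le> r * q x)"

lemma sublinear_scale:
  assumes q: "sublinear q" and "r \<ge> 0"
  shows "q (sm (of_real r) x) = r * q x"
proof (cases "r = 0")
  case False
  with \<open>r \<ge> 0\<close> have r: "r > 0" by simp
  have "q (sm (of_real (1/r)) (sm (of_real r) x)) \<le> (1/r) * q (sm (of_real r) x)"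
    using q r unfolding sublinear_def by (metis divide_pos_pos zero_less_one)
  then have "q x \<le> (1/r) * q (sm (of_real r) x)"
    using r by (simp flip: of_real_mult)
  then have "r * q x \<le> q (sm (of_real r) x)"
    using r by (simp add: field_simps)
  then show ?thesis
    using q r unfolding sublinear_def by (meson antisym)
qed (use q in \<open>simp add: sublinear_def\<close>)

lemma sublinear_minus_ge:
  assumes "sublinear q"
  shows "- q (- x) \<le> q x"
proof -
  have "q (x + - x) \<le> q x + q (- x)" "q 0 = 0"
    using assms unfolding sublinear_def by blast+
  then show ?thesis by simp
qed

text \<open>This sublinear minorant of \<open>q\<close> is pushed down along \<open>y\<close>: the
  term with \<open>t = 1\<close> gives a value of at most \<open>- q y\<close> at
  \<open>- y\<close>. It serves both to show that minimal functionals are additive and to prescribe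
  the value of a functional at one point.\<close>

definition sublinear_along :: "('x \<Rightarrow> real) \<Rightarrow> 'x \<Rightarrow> 'x \<Rightarrow> real" where
  "sublinear_along q y x = (INF t\<in>{0..}. q (x + sm (of_real t) y) - t * q y)"

lemma sublinear_along_bound:
  assumes q: "sublinear q" and "t \<ge> 0"
  shows "- q (- x) \<le> q (x + sm (of_real t) y) - t * q y"
proof -
  have "q (- x + (x + sm (of_real t) y)) \<le> q (- x) + q (x + sm (of_real t) y)"
    using q unfolding sublinear_def by blast
  then show ?thesis
    using sublinear_scale[OF q \<open>t \<ge> 0\<close>, of y] by simp
qed

lemma sublinear_along_le:
  assumes q: "sublinear q" and "t \<ge> 0"
  shows "sublinear_along q y x \<le> q (x + sm (of_real t) y) - t * q y"
  unfolding sublinear_along_def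
  using assms sublinear_along_bound[OF q]
  by (intro cINF_lower bdd_belowI2[where m = "- q (- x)"]) auto

lemma sublinear_along_greatest:
  assumes "\<And>t. t \<ge> 0 \<Longrightarrow> c \<le> q (x + sm (of_real t) y) - t * q y"
  shows "c \<le> sublinear_along q y x"
  unfolding sublinear_along_def using assms by (intro cINF_greatest) auto

lemma sublinear_along:
  assumes q: "sublinear q"
  shows "sublinear (sublinear_along q y)"
  unfolding sublinear_def
proof (intro conjI allI impI)
  show "sublinear_along q y 0 = 0"
  proof (rule antisym)
    show "sublinear_along q y 0 \<le> 0"
      using sublinear_along_le[OF q, of 0 y 0] q by (simp add: sublinear_def)
    show "0 \<le> sublinear_along q y 0"
    proof (rule sublinear_along_greatest)
      fix t :: real assume "t \<ge> 0"
      from sublinear_along_bound[OF q this, of 0 y]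
      show "0 \<le> q (0 + sm (of_real t) y) - t * q y"
        using q by (simp add: sublinear_def)
    qed
  qed
next
  fix u v
  have "sublinear_along q y (u + v) - (q (v + sm (of_real t) y) - t * q y) \<le> sublinear_along q y u"
    if t: "t \<ge> 0" for t
  proof (rule sublinear_along_greatest)
    fix s :: real assume s: "s \<ge> 0"
    have "sublinear_along q y (u + v) \<le> q (u + v + sm (of_real (s + t)) y) - (s + t) * q y"
      using s t by (intro sublinear_along_le[OF q]) auto
    also have "u + v + sm (of_real (s + t)) y = (u + sm (of_real s) y) + (v + sm (of_real t) y)"
      by (simp add: scale_left_distrib)
    also have "q \<dots> \<le> q (u + sm (of_real s) y) + q (v + sm (of_real t) y)"
      using q unfolding sublinear_def by blast
    finally show "sublinear_along q y (u + v) - (q (v + sm (of_real t) y) - t * q y)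
        \<le> q (u + sm (of_real s) y) - s * q y"
      by (simp add: algebra_simps)
  qed
  then have "sublinear_along q y (u + v) - sublinear_along q y u \<le> sublinear_along q y v"
    by (intro sublinear_along_greatest) (simp add: algebra_simps)
  then show "sublinear_along q y (u + v) \<le> sublinear_along q y u + sublinear_along q y v"
    by simp
next
  fix r :: real and x assume r: "r > 0"
  have "sublinear_along q y (sm (of_real r) x) / r \<le> sublinear_along q y x"
  proof (rule sublinear_along_greatest)
    fix t :: real assume t: "t \<ge> 0"
    have "sublinear_along q y (sm (of_real r) x)
        \<le> q (sm (of_real r) x + sm (of_real (r * t)) y) - (r * t) * q y"
      using r t by (intro sublinear_along_le[OF q]) auto
    also have "sm (of_real r) x + sm (of_real (r * t)) y = sm (of_real r) (x + sm (of_real t) y)"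
      by (simp add: scale_right_distrib)
    also have "q \<dots> = r * q (x + sm (of_real t) y)"
      using r by (intro sublinear_scale[OF q]) auto
    finally show "sublinear_along q y (sm (of_real r) x) / r \<le> q (x + sm (of_real t) y) - t * q y"
      using r by (simp add: field_simps)
  qed
  then show "sublinear_along q y (sm (of_real r) x) \<le> r * sublinear_along q y x"
    using r by (simp add: field_simps)
qed

text \<open>The infimum is finite because every member is bounded below by \<open>- p (- x)\<close>
  at \<open>x\<close>. Subadditivity needs the chain: of two members used at \<open>x\<close> and at
  \<open>y\<close>, the smaller one can be used at both.\<close>

lemma sublinear_chain_INF:
  assumes C: "C \<noteq> {}" "\<And>q. q \<in> C \<Longrightarrow> sublinear q" "\<And>q. q \<in> C \<Longrightarrow> q \<le> p"
    and chain: "\<And>q q'. q \<in> C \<Longrightarrow> q' \<in> C \<Longrightarrow> q \<le> q' \<or> q' \<le> q"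
  defines "w \<equiv> \<lambda>x. INF q\<in>C. q x"
  shows "sublinear w" and "\<And>q. q \<in> C \<Longrightarrow> w \<le> q"
proof -
  have bound: "- p (- x) \<le> q x" if "q \<in> C" for q x
  proof -
    have "q (- x) \<le> p (- x)" using C(3)[OF that] by (simp add: le_fun_def)
    then show ?thesis using sublinear_minus_ge[OF C(2)[OF that], of x] by simp
  qed
  have lower: "w x \<le> q x" if "q \<in> C" for q x
    unfolding w_def using that bound
    by (intro cINF_lower bdd_belowI2[where m = "- p (- x)"]) auto
  then show "\<And>q. q \<in> C \<Longrightarrow> w \<le> q" by (simp add: le_fun_def)
  have greatest: "c \<le> w x" if "\<And>q. q \<in> C \<Longrightarrow> c \<le> q x" for c x
    unfolding w_def using that C(1) by (intro cINF_greatest) auto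
  show "sublinear w"
    unfolding sublinear_def
  proof (intro conjI allI impI)
    have "w 0 = (INF q\<in>C. 0)"
      unfolding w_def using C(2) by (intro INF_cong) (auto simp: sublinear_def)
    then show "w 0 = 0" using C(1) by simp
  next
    fix x y
    have two: "w (x + y) \<le> q x + q' y" if mem: "q \<in> C" "q' \<in> C" for q q'
    proof -
      from chain[OF mem] obtain m where m: "m \<in> C" "m \<le> q" "m \<le> q'"
        using mem by (metis order_refl)
      have "w (x + y) \<le> m (x + y)" by (rule lower[OF m(1)])
      also have "\<dots> \<le> m x + m y" using C(2)[OF m(1)] by (simp add: sublinear_def)
      also have "\<dots> \<le> q x + q' y" using m(2,3) by (simp add: le_fun_def add_mono)
      finally show ?thesis .
    qed
    have "w (x + y) - q' y \<le> w x" if "q' \<in> C" for q'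
      using two that by (intro greatest) (simp add: algebra_simps)
    then have "w (x + y) - w x \<le> w y"
      by (intro greatest) (simp add: algebra_simps)
    then show "w (x + y) \<le> w x + w y" by simp
  next
    fix r :: real and x assume r: "r > 0"
    have "w (sm (of_real r) x) / r \<le> w x"
    proof (rule greatest)
      fix q assume q: "q \<in> C"
      have "w (sm (of_real r) x) \<le> r * q x"
        using lower[OF q, of "sm (of_real r) x"] sublinear_scale[OF C(2)[OF q], of r x] r by simp
      then show "w (sm (of_real r) x) / r \<le> q x"
        using r by (simp add: field_simps)
    qed
    then show "w (sm (of_real r) x) \<le> r * w x"
      using r by (simp add: field_simps)
  qed
qed

text \<open>A pointwise minimal sublinear functional coincides with all its \<^const>\<open>sublinear_along\<close>
  minorants, and this forces additivity.\<close>

lemma linear_below_sublinear: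
  assumes p: "sublinear p"
  shows "\<exists>f. (\<forall>x y. f (x + y) = f x + f y) \<and> (\<forall>r x. f (sm (of_real r) x) = r * f x) \<and> f \<le> p"
proof -
  define A where "A = {q. sublinear q \<and> q \<le> p}"
  have "\<exists>m\<in>A. \<forall>q\<in>A. q \<le> m \<longrightarrow> q = m"
  \<comment> \<open>The order is reversed, so that a maximal element in Zorn's lemma is a pointwise
    minimal sublinear functional.\<close>
  proof (rule predicate_Zorn[where P = "\<lambda>q q'. q' \<le> q"])
    show "partial_order_on A (relation_of (\<lambda>q q'. q' \<le> q) A)"
      by (auto simp: partial_order_on_def preorder_on_def refl_on_def trans_def antisym_def relation_of_def)
  next
    fix C assume "C \<in> Chains (relation_of (\<lambda>q q'. q' \<le> q) A)"
    then have C: "C \<subseteq> A" "\<And>q q'. q \<in> C \<Longrightarrow> q' \<in> C \<Longrightarrow> q \<le> q' \<or> q' \<le> q"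
      unfolding Chains_def relation_of_def by auto
    show "\<exists>u\<in>A. \<forall>q\<in>C. u \<le> q"
    proof (cases "C = {}")
      case True
      then show ?thesis using p by (auto simp: A_def)
    next
      case False
      have sub: "\<And>q. q \<in> C \<Longrightarrow> sublinear q" "\<And>q. q \<in> C \<Longrightarrow> q \<le> p"
        using C(1) by (auto simp: A_def)
      note w = sublinear_chain_INF[OF False sub C(2)]
      have "(\<lambda>x. INF q\<in>C. q x) \<le> p"
        using False w(2) sub(2) by (meson all_not_in_conv order_trans)
      then have "(\<lambda>x. INF q\<in>C. q x) \<in> A" using w(1) by (simp add: A_def)
      then show ?thesis using w(2) by blast
    qed
  qed
  then obtain f where f: "sublinear f" "f \<le> p" and min: "\<And>q. q \<in> A \<Longrightarrow> q \<le> f \<Longrightarrow> q = f"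
    by (auto simp: A_def)
  have along: "sublinear_along f y = f" for y
  proof (rule min)
    show "sublinear_along f y \<le> f"
      using sublinear_along_le[OF f(1), of 0 y] by (simp add: le_fun_def)
    then show "sublinear_along f y \<in> A"
      using sublinear_along[OF f(1)] f(2) by (simp add: A_def)
  qed
  have add: "f (x + y) = f x + f y" for x y
  proof (rule antisym)
    show "f (x + y) \<le> f x + f y" using f(1) by (simp add: sublinear_def)
    show "f x + f y \<le> f (x + y)"
      using sublinear_along_le[OF f(1), of 1 y x] by (simp add: along)
  qed
  have minus: "f (- x) = - f x" for x
    using add[of x "- x"] f(1) by (simp add: sublinear_def)
  have "f (sm (of_real r) x) = r * f x" for r x
  proof (cases "r \<ge> 0")
    case True
    then show ?thesis using sublinear_scale[OF f(1)] by simp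
  next
    case False
    then have "f (sm (of_real (- r)) x) = (- r) * f x"
      by (intro sublinear_scale[OF f(1)]) simp
    then show ?thesis using minus[of "sm (of_real r) x"] by simp
  qed
  then show ?thesis using add f(2) by blast
qed

section \<open>Seminorms and norming complex functionals\<close>

lemma seminorm_zero: "seminorm sm p \<Longrightarrow> p 0 = 0"
  unfolding seminorm_def by (metis scale_zero_left norm_zero mult_zero_left)

lemma seminorm_minus: "seminorm sm p \<Longrightarrow> p (- x) = p x"
  unfolding seminorm_def
  by (metis scale_minus_left scale_one norm_minus_cancel norm_one mult_1)

lemma seminorm_nonneg:
  assumes "seminorm sm p" shows "p x \<ge> 0"
proof -
  have "p (x + - x) \<le> p x + p (- x)" using assms unfolding seminorm_def by blast
  then show ?thesis using seminorm_zero[OF assms] seminorm_minus[OF assms, of x] by simp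
qed

lemma seminorm_add: "seminorm sm p \<Longrightarrow> p (x + y) \<le> p x + p y"
  by (simp add: seminorm_def)

lemma seminorm_scale: "seminorm sm p \<Longrightarrow> p (sm c x) = cmod c * p x"
  by (simp add: seminorm_def)

lemma seminorm_diff_commute: "seminorm sm p \<Longrightarrow> p (x - y) = p (y - x)"
  using seminorm_minus[of p "x - y"] by simp

lemma seminorm_diff_trans: "seminorm sm p \<Longrightarrow> p (x - z) \<le> p (x - y) + p (y - z)"
  using seminorm_add[of p "x - y" "y - z"] by simp

lemma seminorm_sum: "seminorm sm p \<Longrightarrow> p (sum u A) \<le> (\<Sum>i\<in>A. p (u i))"
proof (induction A rule: infinite_finite_induct)
  case (insert i A)
  then show ?case using seminorm_add[of p "u i" "sum u A"] by simp
qed (simp_all add: seminorm_zero)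

lemma seminorm_imp_sublinear: "seminorm sm p \<Longrightarrow> sublinear p"
  unfolding sublinear_def by (simp add: seminorm_zero seminorm_add seminorm_scale)

definition clinear :: "('x \<Rightarrow> complex) \<Rightarrow> bool" where
  "clinear f \<longleftrightarrow> (\<forall>x y. f (x + y) = f x + f y) \<and> (\<forall>c x. f (sm c x) = c * f x)"

text \<open>No extension from the span of \<open>x0\<close> is made. A real functional
  \<open>h\<close> below \<open>sublinear_along p x0\<close> satisfies
  \<open>h (- x0) \<le> - p x0\<close>, hence attains \<open>p x0\<close> at \<open>x0\<close>. The
  complex functional with real part \<open>h\<close> is
  \<open>h x - \<i> * h (sm \<i> x)\<close>.\<close>

theorem norming_functional:
  assumes p: "seminorm sm p"
  shows "\<exists>f. clinear f \<and> (\<forall>x. cmod (f x) \<le> p x) \<and> f x0 = of_real (p x0)"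
proof -
  note sub = seminorm_imp_sublinear[OF p]
  obtain h where h: "\<And>x y. h (x + y) = h x + h y" "\<And>r x. h (sm (of_real r) x) = r * h x"
      "h \<le> sublinear_along p x0"
    using linear_below_sublinear[OF sublinear_along[OF sub]] by blast
  have hp: "h x \<le> p x" for x
    using le_funD[OF h(3), of x] sublinear_along_le[OF sub, of 0 x0 x] by simp
  have hm: "h (- x) = - h x" for x using h(2)[of "-1" x] by simp
  have "h (- x0) \<le> - p x0"
    using le_funD[OF h(3), of "- x0"] sublinear_along_le[OF sub, of 1 x0 "- x0"]
    by (simp add: seminorm_zero[OF p])
  then have hx0: "h x0 = p x0" using hp[of x0] by (simp add: hm)
  define f where "f x = Complex (h x) (- h (sm \<i> x))" for x
  have scale: "h (sm c x) = Re c * h x + Im c * h (sm \<i> x)" for c x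
  proof -
    have "sm c x = sm (of_real (Re c)) x + sm (of_real (Im c)) (sm \<i> x)"
      by (simp add: scale_left_distrib[symmetric] complex_eq mult.commute)
    then show ?thesis by (simp only: h)
  qed
  have lin: "clinear f"
    unfolding clinear_def
  proof (intro conjI allI)
    fix c x
    have "h (sm \<i> (sm c x)) = - Im c * h x + Re c * h (sm \<i> x)"
      using scale[of "\<i> * c" x] by simp
    then show "f (sm c x) = c * f x"
      by (simp add: f_def complex_eq_iff scale[of c x])
  qed (simp add: f_def h(1) scale_right_distrib complex_eq_iff)
  have bound: "cmod (f x) \<le> p x" for x
  proof (cases "f x = 0")
    case False
    \<comment> \<open>Rotation by \<open>c\<close> makes the value real and nonnegative, so it
      equals its real part \<open>h (sm c x)\<close>, which \<open>p\<close> dominates.\<close>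
    define c where "c = cnj (sgn (f x))"
    have c: "cmod c = 1" using False by (simp add: c_def norm_sgn)
    have "f (sm c x) = c * f x" using lin by (simp add: clinear_def)
    also have "c * f x = of_real (cmod (f x))"
      using False complex_norm_square[of "f x"]
      by (simp add: c_def sgn_eq field_simps power2_eq_square)
    finally have "cmod (f x) = h (sm c x)" by (simp add: f_def complex_eq_iff)
    also have "\<dots> \<le> p (sm c x)" by (rule hp)
    finally show ?thesis using c p by (simp add: seminorm_scale)
  qed (simp add: seminorm_nonneg[OF p])
  have "Re (f x0) = p x0" by (simp add: f_def hx0)
  \<comment> \<open>The real part at \<open>x0\<close> already exhausts the bound on the modulus, so
    the imaginary part vanishes.\<close>
  moreover have "(Re (f x0))\<^sup>2 + (Im (f x0))\<^sup>2 \<le> (p x0)\<^sup>2"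
    using power_mono[OF bound[of x0], of 2] by (simp add: cmod_power2)
  ultimately have "f x0 = of_real (p x0)" by (simp add: complex_eq_iff)
  then show ?thesis using lin bound by blast
qed

end

section \<open>Locally convex and weak topologies\<close>

locale complete_lcs =
  fixes sm :: "complex \<Rightarrow> 'x::ab_group_add \<Rightarrow> 'x" and P :: "('x \<Rightarrow> real) set"
  assumes complete_hausdorff: "complete_hausdorff_lcs sm P"

sublocale complete_lcs \<subseteq> complex_space sm
  using complete_hausdorff by unfold_locales (simp add: complete_hausdorff_lcs_def)

context complete_lcs
begin

lemma seminorm_P: "p \<in> P \<Longrightarrow> seminorm sm p"
  using complete_hausdorff by (simp add: complete_hausdorff_lcs_def)

lemma eq_zero_if_seminorms_zero: "(\<And>p. p \<in> P \<Longrightarrow> p x = 0) \<Longrightarrow> x = 0"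
  using complete_hausdorff by (auto simp: complete_hausdorff_lcs_def)

lemma openin_lc_ball: "p \<in> P \<Longrightarrow> e > 0 \<Longrightarrow> openin (lc_top P) {y. p (y - x) < e}"
  unfolding lc_top_def by (rule topology_generated_by_Basis) blast

lemma topspace_lc_top [simp]: "topspace (lc_top P) = UNIV"
  unfolding lc_top_def topology_generated_by_topspace by auto

text \<open>The subbasic balls may have any centre; the triangle inequality recentres them at
  \<open>x\<close>. The family \<open>P\<close> is not assumed directed, hence the finite set
  \<open>Q\<close> instead of a single seminorm.\<close>

lemma openin_lc_topD:
  assumes "openin (lc_top P) U" "x \<in> U"
  shows "\<exists>Q e. finite Q \<and> Q \<subseteq> P \<and> e > 0 \<and> {y. \<forall>p\<in>Q. p (y - x) < e} \<subseteq> U"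
proof -
  have "generate_topology_on (insert UNIV {{y. p (y - x) < e} | p x e. p \<in> P \<and> e > 0}) U"
    using assms(1) by (simp add: lc_top_def openin_topology_generated_by_iff)
  then show ?thesis using assms(2)
  proof (induction U arbitrary: x)
    case (Int U V)
    then have x: "x \<in> U" "x \<in> V" by auto
    obtain Q e where "finite Q" "Q \<subseteq> P" "e > 0" "{y. \<forall>p\<in>Q. p (y - x) < e} \<subseteq> U"
      using Int.IH(1)[OF x(1)] by blast
    moreover obtain Q' e' where
      "finite Q'" "Q' \<subseteq> P" "e' > 0" "{y. \<forall>p\<in>Q'. p (y - x) < e'} \<subseteq> V"
      using Int.IH(2)[OF x(2)] by blast
    ultimately show ?case
      by (intro exI[of _ "Q \<union> Q'"] exI[of _ "min e e'"]) auto
  next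
    case (UN K)
    then obtain k where k: "k \<in> K" "x \<in> k" by blast
    with UN.IH[OF k] show ?case by (meson Union_upper subset_trans)
  next
    case (Basis U)
    show ?case
    proof (cases "U = UNIV")
      case True
      then show ?thesis by (intro exI[of _ "{}"] exI[of _ 1]) auto
    next
      case False
      with Basis obtain p z e where U: "U = {y. p (y - z) < e}" "p \<in> P"
        by auto
      have "p (y - z) < e" if "p (y - x) < e - p (x - z)" for y
        using seminorm_diff_trans[OF seminorm_P[OF U(2)], of y z x] that by simp
      then show ?thesis
        using Basis(2) U by (intro exI[of _ "{p}"] exI[of _ "e - p (x - z)"]) auto
    qed
  qed simp
qed

section \<open>Continuous linear functionals\<close>

lemma dual_space_iff:
  "f \<in> dual_space sm P \<longleftrightarrow> clinear f \<and> continuous_map (lc_top P) euclidean f"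
  by (simp add: dual_space_def clinear_def)

lemma clinear_zero: "clinear f \<Longrightarrow> f 0 = 0"
  unfolding clinear_def by (metis scale_zero_left mult_zero_left)

lemma clinear_diff: "clinear f \<Longrightarrow> f (x - y) = f x - f y"
  unfolding clinear_def by (metis diff_add_cancel add_diff_cancel_right')

lemma clinear_add: "clinear f \<Longrightarrow> f (x + y) = f x + f y"
  by (simp add: clinear_def)

lemma clinear_scale: "clinear f \<Longrightarrow> f (sm c x) = c * f x"
  by (simp add: clinear_def)

lemma clinear_sum: "clinear f \<Longrightarrow> f (sum u A) = (\<Sum>i\<in>A. f (u i))"
  by (induction A rule: infinite_finite_induct) (simp_all add: clinear_zero clinear_add)

lemma dual_spaceI:
  assumes f: "clinear f" and p: "p \<in> P" and bound: "\<And>x. cmod (f x) \<le> C * p x"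
  shows "f \<in> dual_space sm P"
  unfolding dual_space_iff
proof (intro conjI f)
  \<comment> \<open>\<open>C\<close> may be zero or negative; \<open>D\<close> is a positive bound,
    so \<open>e / D\<close> is a legitimate radius.\<close>
  define D where "D = max C 1"
  have D: "D > 0" by (simp add: D_def)
  have bound': "cmod (f x) \<le> D * p x" for x
    using bound[of x] mult_right_mono[of C D "p x"] seminorm_nonneg[OF seminorm_P[OF p], of x]
    by (simp add: D_def)
  show "continuous_map (lc_top P) euclidean f"
    unfolding continuous_map_def
  proof (intro conjI allI impI)
    fix U :: "complex set" assume "openin euclidean U"
    then have U: "open U" by simp
    show "openin (lc_top P) {x \<in> topspace (lc_top P). f x \<in> U}"
    proof (subst openin_subopen, intro ballI)
      fix x assume "x \<in> {x \<in> topspace (lc_top P). f x \<in> U}"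
      then obtain e where e: "e > 0" "ball (f x) e \<subseteq> U"
        using U open_contains_ball by blast
      have "f y \<in> U" if "p (y - x) < e / D" for y
      proof -
        have "cmod (f y - f x) \<le> D * p (y - x)"
          using bound'[of "y - x"] by (simp add: clinear_diff[OF f])
        also have "\<dots> < e" using that D by (simp add: field_simps)
        finally show ?thesis using e(2) by (auto simp: dist_norm norm_minus_commute)
      qed
      then show "\<exists>T. openin (lc_top P) T \<and> x \<in> T \<and> T \<subseteq> {x \<in> topspace (lc_top P). f x \<in> U}"
        using openin_lc_ball[OF p, of "e / D" x] e(1) D seminorm_zero[OF seminorm_P[OF p]]
        by (intro exI[of _ "{y. p (y - x) < e / D}"]) auto
    qed
  qed auto
qed

section \<open>The weak topology\<close>

abbreviation "W \<equiv> weak_top sm P"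

lemma topspace_weak_top [simp]: "topspace W = UNIV"
  unfolding weak_top_def topology_generated_by_topspace by auto

lemma continuous_map_dual: "f \<in> dual_space sm P \<Longrightarrow> continuous_map W euclidean f"
  unfolding continuous_map_def
proof (intro conjI allI impI)
  fix U :: "complex set" assume f: "f \<in> dual_space sm P" and "openin euclidean U"
  then have "openin W (f -` U)"
    unfolding weak_top_def by (intro topology_generated_by_Basis) auto
  then show "openin W {x \<in> topspace W. f x \<in> U}" by (simp add: vimage_def)
qed auto

lemma continuous_map_weak_iff:
  "continuous_map X W \<phi> \<longleftrightarrow> (\<forall>f\<in>dual_space sm P. continuous_map X euclidean (\<lambda>x. f (\<phi> x)))"
proof (intro iffI ballI)
  fix f assume "continuous_map X W \<phi>" "f \<in> dual_space sm P"
  then show "continuous_map X euclidean (\<lambda>x. f (\<phi> x))"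
    using continuous_map_compose[OF _ continuous_map_dual] by (fastforce simp: o_def)
next
  assume R: "\<forall>f\<in>dual_space sm P. continuous_map X euclidean (\<lambda>x. f (\<phi> x))"
  have "openin X (\<phi> -` (f -` U) \<inter> topspace X)" if "f \<in> dual_space sm P" "open U" for f U
  proof -
    have "openin X {x \<in> topspace X. f (\<phi> x) \<in> U}"
      using R that by (auto simp: continuous_map_def)
    moreover have "{x \<in> topspace X. f (\<phi> x) \<in> U} = \<phi> -` (f -` U) \<inter> topspace X" by auto
    ultimately show ?thesis by simp
  qed
  then show "continuous_map X W \<phi>"
    unfolding weak_top_def continuous_on_generated_topo_iff by auto
qed

lemma continuous_map_weak_add:
  "continuous_map X W \<phi> \<Longrightarrow> continuous_map X W \<psi> \<Longrightarrow> continuous_map X W (\<lambda>x. \<phi> x + \<psi> x)"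
  by (simp add: continuous_map_weak_iff dual_space_iff clinear_add continuous_map_add)

lemma continuous_map_weak_diff:
  "continuous_map X W \<phi> \<Longrightarrow> continuous_map X W \<psi> \<Longrightarrow> continuous_map X W (\<lambda>x. \<phi> x - \<psi> x)"
  by (simp add: continuous_map_weak_iff dual_space_iff clinear_diff continuous_map_diff)

lemma continuous_map_weak_scale:
  "continuous_map X W \<phi> \<Longrightarrow> continuous_map X W (\<lambda>x. sm c (\<phi> x))"
  unfolding continuous_map_weak_iff
  by (simp add: dual_space_iff clinear_scale continuous_map_atin tendsto_mult_left)

lemma continuous_map_weak_sum:
  assumes "finite I" "\<And>i. i \<in> I \<Longrightarrow> continuous_map X W (\<lambda>x. \<phi> x i)"
  shows "continuous_map X W (\<lambda>x. sum (\<phi> x) I)"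
  using assms by (simp add: continuous_map_weak_iff dual_space_iff clinear_sum continuous_map_sum)

lemma norming_dual:
  assumes "p \<in> P"
  shows "\<exists>f\<in>dual_space sm P. (\<forall>x. cmod (f x) \<le> p x) \<and> f x0 = of_real (p x0)"
proof -
  obtain f where f: "clinear f" "\<forall>x. cmod (f x) \<le> p x" "f x0 = of_real (p x0)"
    using norming_functional[OF seminorm_P[OF assms]] by blast
  then have "f \<in> dual_space sm P" by (intro dual_spaceI[OF f(1) assms, of 1]) simp
  then show ?thesis using f by blast
qed

lemma Hausdorff_weak_top: "Hausdorff_space W"
  unfolding Hausdorff_space_def
proof (intro allI impI, elim conjE)
  fix x y :: 'x assume "x \<noteq> y"
  then obtain p where p: "p \<in> P" "p (x - y) \<noteq> 0"
    using eq_zero_if_seminorms_zero[of "x - y"] by auto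
  obtain f where f: "f \<in> dual_space sm P" "f (x - y) = of_real (p (x - y))"
    using norming_dual[OF p(1)] by blast
  then have ne: "f x \<noteq> f y"
    using p(2) clinear_diff[of f x y] by (auto simp: dual_space_iff)
  obtain U V where UV: "open U" "open V" "f x \<in> U" "f y \<in> V" "U \<inter> V = {}"
    using hausdorff[OF ne] by blast
  have op: "openin W (f -` S)" if "open S" for S
    unfolding weak_top_def using f(1) that by (intro topology_generated_by_Basis) auto
  show "\<exists>U V. openin W U \<and> openin W V \<and> x \<in> U \<and> y \<in> V \<and> disjnt U V"
    using UV op by (intro exI[of _ "f -` U"] exI[of _ "f -` V"]) (auto simp: disjnt_def)
qed

lemma compactin_weak_imp_closedin: "compactin W K \<Longrightarrow> closedin W K"
  by (rule compactin_imp_closedin[OF Hausdorff_weak_top])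

lemma compactin_weak_add:
  assumes "compactin W K" "compactin W L"
  shows "compactin W {x + y | x y. x \<in> K \<and> y \<in> L}"
proof -
  have "compactin (prod_topology W W) (K \<times> L)"
    using assms by (simp add: compactin_Times)
  moreover have "continuous_map (prod_topology W W) W (\<lambda>z. fst z + snd z)"
    by (intro continuous_map_weak_add continuous_map_fst continuous_map_snd)
  ultimately have "compactin W ((\<lambda>z. fst z + snd z) ` (K \<times> L))"
    by (rule image_compactin)
  moreover have "(\<lambda>z. fst z + snd z) ` (K \<times> L) = {x + y | x y. x \<in> K \<and> y \<in> L}"
    by force
  ultimately show ?thesis by simp
qed

lemma compactin_weak_scale:
  assumes "compactin W K" shows "compactin W (sm c ` K)"
  by (rule image_compactin[OF assms]) (intro continuous_map_weak_scale continuous_map_id[unfolded id_def])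

text \<open>By the norming functionals, \<open>p\<close> is the supremum of the moduli of the
  functionals it dominates, so the ball is an intersection of weakly closed sets. This lets
  estimates in \<open>p\<close> survive weak cluster points.\<close>

lemma closedin_weak_seminorm_ball:
  assumes p: "p \<in> P"
  shows "closedin W {x. p (x - z) \<le> e}"
proof -
  define F where "F = {f \<in> dual_space sm P. \<forall>x. cmod (f x) \<le> p x}"
  have "{x. p (x - z) \<le> e} = (\<Inter>f\<in>F. {x \<in> topspace W. f (x - z) \<in> cball 0 e})"
  proof (intro equalityI subsetI)
    fix x assume "x \<in> (\<Inter>f\<in>F. {x \<in> topspace W. f (x - z) \<in> cball 0 e})"
    moreover obtain f where f: "f \<in> F" "f (x - z) = of_real (p (x - z))"
      using norming_dual[OF p, of "x - z"] by (auto simp: F_def)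
    ultimately have "f (x - z) \<in> cball 0 e" by auto
    then show "x \<in> {x. p (x - z) \<le> e}"
      using f(2) seminorm_nonneg[OF seminorm_P[OF p], of "x - z"] by simp
  next
    fix x assume "x \<in> {x. p (x - z) \<le> e}"
    then show "x \<in> (\<Inter>f\<in>F. {x \<in> topspace W. f (x - z) \<in> cball 0 e})"
      unfolding F_def using order_trans by auto
  qed
  moreover have "closedin W {x \<in> topspace W. f (x - z) \<in> cball 0 e}" if "f \<in> F" for f
  proof (rule closedin_continuous_map_preimage)
    have "continuous_map W W (\<lambda>x. x - z)"
      by (intro continuous_map_weak_diff continuous_map_id[unfolded id_def] continuous_map_const[THEN iffD2]) auto
    then show "continuous_map W euclidean (\<lambda>x. f (x - z))"
      using that by (simp add: F_def continuous_map_weak_iff)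
  qed simp
  moreover have "F \<noteq> {}" using norming_dual[OF p] by (auto simp: F_def)
  ultimately show ?thesis by (metis (no_types, lifting) closedin_INT)
qed

section \<open>Limits of sequences and completeness\<close>

definition lc_limit :: "(nat \<Rightarrow> 'x) \<Rightarrow> 'x \<Rightarrow> bool" where
  "lc_limit S l \<longleftrightarrow> (\<forall>p\<in>P. (\<lambda>n. p (S n - l)) \<longlonglongrightarrow> 0)"

lemma complete_seq:
  assumes "\<And>p e. p \<in> P \<Longrightarrow> e > 0 \<Longrightarrow> \<exists>N. \<forall>m\<ge>N. \<forall>n\<ge>N. p (S m - S n) < e"
  shows "\<exists>l. lc_limit S l"
proof -
  have "cauchy_filter P (filtermap S sequentially)"
    unfolding cauchy_filter_def
  proof (intro conjI ballI allI impI)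
    fix p and e :: real assume "p \<in> P" "e > 0"
    then obtain N where N: "\<forall>m\<ge>N. \<forall>n\<ge>N. p (S m - S n) < e" using assms by blast
    then show "\<exists>A. eventually (\<lambda>x. x \<in> A) (filtermap S sequentially) \<and> (\<forall>x\<in>A. \<forall>y\<in>A. p (x - y) < e)"
      by (intro exI[of _ "S ` {N..}"]) (auto simp: eventually_filtermap eventually_sequentially)
  qed (simp add: filtermap_bot_iff)
  then obtain l where l: "limitin (lc_top P) id l (filtermap S sequentially)"
    using complete_hausdorff unfolding complete_hausdorff_lcs_def by blast
  have "lc_limit S l"
    unfolding lc_limit_def
  proof
    fix p assume p: "p \<in> P"
    show "(\<lambda>n. p (S n - l)) \<longlonglongrightarrow> 0"
    proof (rule order_tendstoI)
      fix e :: real assume "e < 0"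
      then show "\<forall>\<^sub>F n in sequentially. e < p (S n - l)"
        using seminorm_nonneg[OF seminorm_P[OF p]] by (auto intro: always_eventually less_le_trans)
    next
      fix e :: real assume e: "0 < e"
      then show "\<forall>\<^sub>F n in sequentially. p (S n - l) < e"
        using l openin_lc_ball[OF p e, of l] seminorm_zero[OF seminorm_P[OF p]]
        unfolding limitin_def by (auto simp: eventually_filtermap)
    qed
  qed
  then show ?thesis by blast
qed

lemma lc_limit_dual:
  assumes S: "lc_limit S l" and f: "f \<in> dual_space sm P"
  shows "(\<lambda>n. f (S n)) \<longlonglongrightarrow> f l"
proof -
  have "limitin (lc_top P) S l sequentially"
    unfolding limitin_def
  proof (intro conjI allI impI; (elim conjE)?)
    fix U assume U: "openin (lc_top P) U" "l \<in> U"
    obtain Q e where Q: "finite Q" "Q \<subseteq> P" "e > 0" "{y. \<forall>p\<in>Q. p (y - l) < e} \<subseteq> U"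
      using openin_lc_topD[OF U] by blast
    have "\<forall>\<^sub>F n in sequentially. \<forall>p\<in>Q. p (S n - l) < e"
      using Q S by (intro eventually_ball_finite) (auto simp: lc_limit_def intro: order_tendstoD(2))
    then show "\<forall>\<^sub>F n in sequentially. S n \<in> U"
      by (rule eventually_mono) (use Q(4) in auto)
  qed simp
  then have "limitin euclidean (f \<circ> S) (f l) sequentially"
    using f by (intro continuous_map_limit) (auto simp: dual_space_iff)
  then show ?thesis by (simp add: o_def)
qed

text \<open>Together with closedness of weakly compact sets, this keeps limits of Riemann--Stieltjes
  sums inside the weakly compact set containing the sums.\<close>

lemma lc_limit_weak: "lc_limit S l \<Longrightarrow> limitin W S l sequentially"
  unfolding limitin_def
proof (intro conjI allI impI; (elim conjE)?)
  fix U assume S: "lc_limit S l" and "openin W U" "l \<in> U"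
  then have "generate_topology_on (insert UNIV {f -` U | f U. f \<in> dual_space sm P \<and> open U}) U"
    by (simp add: weak_top_def openin_topology_generated_by_iff)
  then show "\<forall>\<^sub>F n in sequentially. S n \<in> U" using \<open>l \<in> U\<close>
  proof (induction U)
    case (Int U V)
    then show ?case by (simp add: eventually_conj)
  next
    case (UN K)
    then obtain k where "k \<in> K" "\<forall>\<^sub>F n in sequentially. S n \<in> k" by blast
    then show ?case by (auto elim: eventually_mono)
  next
    case (Basis U)
    show ?case
    proof (cases "U = UNIV")
      case False
      with Basis obtain f V where "U = f -` V" "f \<in> dual_space sm P" "open V" by auto
      then show ?thesis
        using topological_tendstoD[OF lc_limit_dual[OF S]] Basis(2) by auto
    qed simp
  qed simp
qed simp

lemma lc_limit_closedin:
  assumes "lc_limit S l" "closedin W C" "\<And>n. S n \<in> C"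
  shows "l \<in> C"
  using limitin_closedin[OF lc_limit_weak[OF assms(1)] assms(2)] assms(3) by simp

lemma lc_limit_unique:
  assumes "lc_limit S l" "lc_limit S m" shows "l = m"
  using limitin_Hausdorff_unique[OF lc_limit_weak[OF assms(1)] lc_limit_weak[OF assms(2)]]
  by (simp add: Hausdorff_weak_top)

lemma lc_limit_add:
  assumes "lc_limit S l" "lc_limit R m" shows "lc_limit (\<lambda>n. S n + R n) (l + m)"
  unfolding lc_limit_def
proof
  fix p assume p: "p \<in> P"
  have lim: "(\<lambda>n. p (S n - l) + p (R n - m)) \<longlonglongrightarrow> 0"
    using assms p tendsto_add[of "\<lambda>n. p (S n - l)" 0 _ "\<lambda>n. p (R n - m)" 0] by (simp add: lc_limit_def)
  have bd: "norm (p (S n + R n - (l + m))) \<le> p (S n - l) + p (R n - m)" for n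
    using seminorm_add[OF seminorm_P[OF p], of "S n - l" "R n - m"] seminorm_nonneg[OF seminorm_P[OF p]]
    by (simp add: algebra_simps)
  show "(\<lambda>n. p (S n + R n - (l + m))) \<longlonglongrightarrow> 0"
    by (rule Lim_null_comparison[OF always_eventually[OF allI[OF bd]] lim])
qed

lemma lc_limit_scale:
  assumes "lc_limit S l" shows "lc_limit (\<lambda>n. sm c (S n)) (sm c l)"
  unfolding lc_limit_def
proof
  fix p assume p: "p \<in> P"
  have "(\<lambda>n. cmod c * p (S n - l)) \<longlonglongrightarrow> 0"
    using assms p by (intro tendsto_mult_right_zero) (simp add: lc_limit_def)
  then show "(\<lambda>n. p (sm c (S n) - sm c l)) \<longlonglongrightarrow> 0"
    by (simp add: seminorm_scale[OF seminorm_P[OF p]] flip: scale_right_diff_distrib)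
qed

section \<open>Weakly bounded sets are bounded\<close>

text \<open>Gliding hump: if \<open>p\<close> were unbounded on \<open>A\<close>, then a series of norming functionals, with signs
  chosen one after the other, would be unbounded on \<open>A\<close>.\<close>

theorem weakly_bounded_imp_bounded:
  assumes p: "p \<in> P" and A: "\<And>f. f \<in> dual_space sm P \<Longrightarrow> \<exists>B. \<forall>x\<in>A. cmod (f x) \<le> B"
  shows "\<exists>B. \<forall>x\<in>A. p x \<le> B"
proof (rule ccontr)
  assume "\<not> ?thesis"
  \<comment> \<open>The rate \<open>4 ^ n\<close> is chosen to beat the weights
    \<open>(1/3) ^ n\<close> of the series of functionals below.\<close>
  then have "\<forall>n. \<exists>x\<in>A. p x > 4 ^ n" by (meson not_le)
  then obtain X where X: "\<And>n::nat. X n \<in> A" "\<And>n. p (X n) > 4 ^ n" by metis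
  note sem = seminorm_P[OF p]
  \<comment> \<open>The \<open>f n\<close> are the partial sums of the series. The clause on
    \<open>n = 0\<close> fixes the initial value inside the invariant of the recursive
    choice.\<close>
  have "\<exists>f. \<forall>n. (clinear (f n) \<and> (n = 0 \<longrightarrow> f n = (\<lambda>x. 0))) \<and>
      ((\<forall>x. cmod (f (Suc n) x - f n x) \<le> (1/3) ^ n * p x) \<and>
       cmod (f (Suc n) (X n)) \<ge> (1/3) ^ n * p (X n))"
  proof (rule dependent_nat_choice)
    show "\<exists>f. clinear f \<and> (0 = (0::nat) \<longrightarrow> f = (\<lambda>x. 0))"
      by (simp add: clinear_def)
  next
    fix f :: "'x \<Rightarrow> complex" and n :: nat
    assume "clinear f \<and> (n = 0 \<longrightarrow> f = (\<lambda>x. 0))"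
    then have f: "clinear f" by simp
    obtain h where h: "clinear h" "\<And>x. cmod (h x) \<le> p x" "h (X n) = of_real (p (X n))"
      using norming_functional[OF sem] by blast
    define c :: complex where "c = (1/3) ^ n"
    have c: "cmod c = (1/3) ^ n" by (simp add: c_def norm_power norm_divide)
    have lin: "clinear (\<lambda>x. f x + d * h x)" for d
      using f h(1) by (simp add: clinear_def algebra_simps)
    have diff: "cmod (f x + d * h x - f x) \<le> (1/3) ^ n * p x" if "cmod d = (1/3) ^ n" for x d
      using mult_left_mono[OF h(2)[of x], of "(1/3) ^ n"] that by (simp add: norm_mult)
    \<comment> \<open>The values at \<open>X n\<close> for the coefficients \<open>c\<close> and
      \<open>- c\<close> differ by \<open>2 * (c * h (X n))\<close>, so at least one of them has
      modulus at least \<open>(1/3) ^ n * p (X n)\<close>.\<close>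
    have "cmod (2 * (c * h (X n))) \<le> cmod (f (X n) + c * h (X n)) + cmod (f (X n) + (- c) * h (X n))"
      using norm_triangle_ineq4[of "f (X n) + c * h (X n)" "f (X n) + (- c) * h (X n)"]
      by (simp add: algebra_simps)
    moreover have "cmod (2 * (c * h (X n))) = 2 * ((1/3) ^ n * p (X n))"
      using seminorm_nonneg[OF sem, of "X n"] by (simp add: norm_mult c h(3))
    ultimately have "\<exists>d. cmod d = (1/3) ^ n \<and> cmod (f (X n) + d * h (X n)) \<ge> (1/3) ^ n * p (X n)"
      using c norm_minus_cancel[of c]
      by (smt (verit, best))
    then obtain d where d: "cmod d = (1/3) ^ n" "cmod (f (X n) + d * h (X n)) \<ge> (1/3) ^ n * p (X n)"
      by blast
    show "\<exists>g. (clinear g \<and> (Suc n = 0 \<longrightarrow> g = (\<lambda>x. 0))) \<and>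
        ((\<forall>x. cmod (g x - f x) \<le> (1/3) ^ n * p x) \<and> cmod (g (X n)) \<ge> (1/3) ^ n * p (X n))"
      using lin[of d] diff[OF d(1)] d(2) by (intro exI[of _ "\<lambda>x. f x + d * h x"]) simp
  qed
  then obtain f where f: "\<And>n. clinear (f n)" "f 0 = (\<lambda>x. 0)"
      "\<And>n x. cmod (f (Suc n) x - f n x) \<le> (1/3) ^ n * p x"
      "\<And>n. cmod (f (Suc n) (X n)) \<ge> (1/3) ^ n * p (X n)"
    by (metis (mono_tags, lifting))
  have geo: "summable (\<lambda>n. (1/3) ^ n * p x)" for x
    by (intro summable_mult2 summable_geometric) simp
  have summ: "summable (\<lambda>n. f (Suc n) x - f n x)" for x
    by (rule summable_comparison_test'[OF geo[of x], of 0]) (simp add: f(3))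
  define F where "F x = (\<Sum>n. f (Suc n) x - f n x)" for x
  have lim: "(\<lambda>n. f n x) \<longlonglongrightarrow> F x" for x
  proof -
    have "(\<lambda>n. \<Sum>i<n. f (Suc i) x - f i x) \<longlonglongrightarrow> F x"
      unfolding F_def by (rule summable_LIMSEQ[OF summ])
    moreover have "(\<Sum>i<n. f (Suc i) x - f i x) = f n x" for n
      using sum_lessThan_telescope[of "\<lambda>i. f i x" n] f(2) by simp
    ultimately show ?thesis by simp
  qed
  have lin: "clinear F"
    unfolding clinear_def
  proof (intro conjI allI)
    fix x y
    have "(\<lambda>n. f n (x + y)) \<longlonglongrightarrow> F x + F y"
      using tendsto_add[OF lim[of x] lim[of y]] by (simp add: clinear_add[OF f(1)])
    then show "F (x + y) = F x + F y" using lim LIMSEQ_unique by blast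
  next
    fix c x
    have "(\<lambda>n. f n (sm c x)) \<longlonglongrightarrow> c * F x"
      using tendsto_mult_left[OF lim[of x], of c] by (simp add: clinear_scale[OF f(1)])
    then show "F (sm c x) = c * F x" using lim LIMSEQ_unique by blast
  qed
  have tail: "cmod (F x - f n x) \<le> 3/2 * (1/3) ^ n * p x" for n x
  proof -
    have "F x - f n x = (\<Sum>i. f (Suc (i + n)) x - f (i + n) x)"
      using suminf_split_initial_segment[OF summ[of x], of n] sum_lessThan_telescope[of "\<lambda>i. f i x" n] f(2)
      by (simp add: F_def)
    also have "cmod \<dots> \<le> (\<Sum>i. (1/3) ^ (i + n) * p x)"
      using f(3) summable_ignore_initial_segment[OF geo[of x]] by (intro norm_suminf_le) auto
    also have "(\<lambda>i. (1/3) ^ (i + n) * p x) = (\<lambda>i. (1/3) ^ i * ((1/3) ^ n * p x))"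
      by (simp add: power_add mult.assoc)
    also have "(\<Sum>i. (1/3) ^ i * ((1/3) ^ n * p x)) = 3/2 * (1/3) ^ n * p x"
      by (subst suminf_mult2[symmetric]) (simp_all add: summable_geometric suminf_geometric)
    finally show ?thesis .
  qed
  have "F \<in> dual_space sm P"
    using tail[of _ 0] f(2) by (intro dual_spaceI[OF lin p, of "3/2"]) simp
  then obtain B where B: "\<And>n. cmod (F (X n)) \<le> B" using A X(1) by blast
  have "(4/3) ^ n / 2 \<le> B" for n
  proof -
    have "(4/3) ^ n / 2 = (1/3) ^ n * 4 ^ n / (2::real)" by (simp add: power_divide)
    also have "\<dots> \<le> (1/3) ^ n * p (X n) / 2"
      using X(2)[of n] by (intro divide_right_mono mult_left_mono) auto
    \<comment> \<open>The tail after step \<open>Suc n\<close> is at most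
      \<open>3/2 * (1/3) ^ Suc n * p (X n)\<close>, which is half of what step \<open>n\<close>
      gained.\<close>
    also have "\<dots> \<le> cmod (f (Suc n) (X n)) - cmod (F (X n) - f (Suc n) (X n))"
      using tail[of "X n" "Suc n"] f(4)[of n] by simp
    also have "\<dots> \<le> cmod (F (X n))"
      using norm_triangle_ineq4[of "F (X n)" "F (X n) - f (Suc n) (X n)"] by simp
    finally show ?thesis using B[of n] by simp
  qed
  moreover obtain n where "(4/3::real) ^ n > 2 * B"
    using real_arch_pow[of "4/3" "2 * B"] by auto
  ultimately show False by (smt (verit) field_sum_of_halves)
qed

corollary weakly_compact_imp_bounded:
  assumes "p \<in> P" "compactin W K"
  shows "\<exists>B. \<forall>x\<in>K. p x \<le> B"
proof (rule weakly_bounded_imp_bounded[OF assms(1)])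
  fix f assume "f \<in> dual_space sm P"
  then have "compact (f ` K)"
    using image_compactin[OF assms(2) continuous_map_dual] by simp
  then show "\<exists>B. \<forall>x\<in>K. cmod (f x) \<le> B"
    using compact_imp_bounded bounded_iff by (metis imageI)
qed

section \<open>Dyadic series over a weakly compact set\<close>

lemma norm_dyadic [simp]: "cmod ((1/2) ^ n) = (1/2) ^ n"
  by (simp add: norm_power norm_divide)

text \<open>The set \<open>L\<close> is the image of the countable power of \<open>K\<close>,
  compact by Tychonoff's theorem, under the map sending a sequence to the sum of its series.
  Boundedness of \<open>K\<close> gives geometric tails, hence convergence by completeness and weak
  continuity of the map.\<close>

lemma weakly_compact_dyadic_series:
  assumes K: "compactin W K"
  shows "\<exists>L. compactin W L \<and>
    (\<forall>e z. range e \<subseteq> K \<longrightarrow> lc_limit (\<lambda>n. \<Sum>i<n. sm ((1/2) ^ Suc i) (e i)) z \<longrightarrow> z \<in> L)"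
proof -
  define S where "S e n = (\<Sum>i<n. sm ((1/2) ^ Suc i) (e i))" for e n
  \<comment> \<open>Stated for any seminorm bounded on \<open>K\<close>, since it is applied both to
    the members of \<open>P\<close> and to the modulus of a dual functional.\<close>
  have tail: "p (S e n - S e m) \<le> (1/2) ^ m * B"
    if p: "seminorm sm p" and B: "\<forall>x\<in>K. p x \<le> B" and e: "range e \<subseteq> K" and "m \<le> n" for p B e m n
  proof -
    have bound: "p (S e (m + k) - S e m) \<le> ((1/2) ^ m - (1/2) ^ (m + k)) * B" for k
    proof (induction k)
      case (Suc k)
      have "S e (m + Suc k) - S e m = (S e (m + k) - S e m) + sm ((1/2) ^ Suc (m + k)) (e (m + k))"
        by (simp add: S_def)
      also have "p \<dots> \<le> p (S e (m + k) - S e m) + (1/2) ^ Suc (m + k) * p (e (m + k))"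
        using seminorm_add[OF p, of "S e (m + k) - S e m" "sm ((1/2) ^ Suc (m + k)) (e (m + k))"]
        unfolding seminorm_scale[OF p] norm_dyadic .
      also have "\<dots> \<le> ((1/2) ^ m - (1/2) ^ (m + k)) * B + (1/2) ^ Suc (m + k) * B"
        using Suc B e by (intro add_mono mult_left_mono) auto
      also have "\<dots> = ((1/2) ^ m - (1/2) ^ (m + Suc k)) * B"
        by (simp add: algebra_simps)
      finally show ?case .
    qed (simp add: seminorm_zero[OF p])
    have "B \<ge> 0"
      using B e seminorm_nonneg[OF p, of "e 0"] by (meson order_trans rangeI subsetD)
    then have "((1/2) ^ m - (1/2) ^ (m + (n - m))) * B \<le> (1/2) ^ m * B"
      by (intro mult_right_mono) auto
    then show ?thesis using bound[of "n - m"] \<open>m \<le> n\<close> by simp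
  qed
  have "\<exists>z. lc_limit (S e) z" if e: "range e \<subseteq> K" for e
  proof (rule complete_seq)
    fix p and d :: real assume p: "p \<in> P" and d: "d > 0"
    obtain B where B: "\<forall>x\<in>K. p x \<le> B"
      using weakly_compact_imp_bounded[OF p K] by blast
    have "(\<lambda>m. (1/2) ^ m * B) \<longlonglongrightarrow> 0"
      by (intro tendsto_mult_left_zero LIMSEQ_power_zero) simp
    then have "\<forall>\<^sub>F m in sequentially. (1/2) ^ m * B < d" using d by (rule order_tendstoD)
    then obtain N where N: "\<And>m. m \<ge> N \<Longrightarrow> (1/2) ^ m * B < d"
      by (auto simp: eventually_sequentially)
    have "p (S e m - S e n) < d" if "m \<ge> N" "n \<ge> N" for m n
    proof (cases "m \<le> n")
      case True
      have "p (S e m - S e n) = p (S e n - S e m)"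
        by (rule seminorm_diff_commute[OF seminorm_P[OF p]])
      then show ?thesis using tail[OF seminorm_P[OF p] B e True] N[OF that(1)] by simp
    next
      case False
      then show ?thesis using tail[OF seminorm_P[OF p] B e, of n m] N[OF that(2)] by simp
    qed
    then show "\<exists>N. \<forall>m\<ge>N. \<forall>n\<ge>N. p (S e m - S e n) < d" by blast
  qed
  then obtain I where I: "\<And>e. range e \<subseteq> K \<Longrightarrow> lc_limit (S e) (I e)" by metis
  define X where "X = product_topology (\<lambda>i::nat. subtopology W K) UNIV"
  have top: "e \<in> topspace X \<longleftrightarrow> range e \<subseteq> K" for e
    by (auto simp: X_def)
  have "compact_space X"
    unfolding X_def using K by (simp add: compact_space_product_topology compact_space_subtopology)
  moreover have "continuous_map X W I"
    unfolding continuous_map_weak_iff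
  proof
    fix f assume f: "f \<in> dual_space sm P"
    have lin: "clinear f" using f by (simp add: dual_space_iff)
    have sem: "seminorm sm (\<lambda>x. cmod (f x))"
      by (simp add: seminorm_def clinear_add[OF lin] clinear_scale[OF lin] norm_triangle_ineq norm_mult)
    have "compact (f ` K)"
      using image_compactin[OF K continuous_map_dual[OF f]] by simp
    then obtain B where "\<And>z. z \<in> f ` K \<Longrightarrow> cmod z \<le> B"
      using compact_imp_bounded bounded_iff by metis
    then have B: "\<And>x. x \<in> K \<Longrightarrow> cmod (f x) \<le> max B 1" by fastforce
    have tailf: "cmod (f (S e n) - f (I e)) \<le> (1/2) ^ n * max B 1" if e: "range e \<subseteq> K" for e n
    proof (rule tendsto_upperbound)
      show "(\<lambda>m. cmod (f (S e n) - f (S e m))) \<longlonglongrightarrow> cmod (f (S e n) - f (I e))"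
        by (intro tendsto_intros lc_limit_dual[OF I[OF e] f])
      have "cmod (f (S e n) - f (S e m)) \<le> (1/2) ^ n * max B 1" if "n \<le> m" for m
        using tail[OF sem _ e that, of "max B 1"] B
        by (simp add: clinear_diff[OF lin] norm_minus_commute)
      then show "\<forall>\<^sub>F m in sequentially. cmod (f (S e n) - f (S e m)) \<le> (1/2) ^ n * max B 1"
        unfolding eventually_sequentially by blast
    qed simp
    \<comment> \<open>The tail bound \<open>tailf\<close> does not depend on the sequence
      \<open>e\<close>, so the sum is a uniform limit of the continuous partial sums after
      composition with \<open>f\<close>.\<close>
    have "continuous_map X Met_TC.mtopology (\<lambda>e. f (I e))"
    proof (rule Met_TC.continuous_map_uniform_limit)
      have proj: "continuous_map X W (\<lambda>e. e i)" for i
        using continuous_map_product_projection[of i UNIV "\<lambda>i. subtopology W K"]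
        by (simp add: X_def continuous_map_in_subtopology)
      have "continuous_map X W (\<lambda>e. S e n)" for n
        unfolding S_def by (intro continuous_map_weak_sum continuous_map_weak_scale proj) simp
      then show "\<forall>\<^sub>F n in sequentially. continuous_map X Met_TC.mtopology (\<lambda>e. f (S e n))"
        using f by (simp add: continuous_map_weak_iff)
      fix d :: real assume d: "d > 0"
      have "(\<lambda>n. (1/2) ^ n * max B 1) \<longlonglongrightarrow> 0"
        by (intro tendsto_mult_left_zero LIMSEQ_power_zero) simp
      then have "\<forall>\<^sub>F n in sequentially. (1/2) ^ n * max B 1 < d" using d by (rule order_tendstoD)
      then show "\<forall>\<^sub>F n in sequentially. \<forall>e\<in>topspace X. f (I e) \<in> UNIV \<and> dist (f (S e n)) (f (I e)) < d"
        by (rule eventually_mono) (auto simp: top dist_norm intro: le_less_trans[OF tailf])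
    qed simp
    then show "continuous_map X euclidean (\<lambda>e. f (I e))" by simp
  qed
  ultimately have "compactin W (I ` topspace X)"
    by (simp add: compact_space_def image_compactin)
  moreover have "z \<in> I ` topspace X" if "range e \<subseteq> K" "lc_limit (S e) z" for e z
    using lc_limit_unique[OF that(2) I[OF that(1)]] that(1) top by blast
  ultimately show ?thesis
    unfolding S_def by (intro exI[of _ "I ` topspace X"]) blast
qed

end

section \<open>Sums of increments\<close>

lemma nondecreasing_prefix:
  fixes w :: "nat \<Rightarrow> real"
  assumes "\<And>k. k < N \<Longrightarrow> w k \<le> w (Suc k)" "i \<le> j" "j \<le> N"
  shows "w i \<le> w j"
  using assms(2,3)
proof (induction j rule: dec_induct)
  case (step j)
  then show ?case using assms(1)[of j] by simp
qed simp

text \<open>Degenerate intervals contribute nothing and are dropped. When the last interval recorded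
  so far ends exactly at \<open>w N\<close>, the new one is merged with it by telescoping; otherwise
  it is appended. This restores the strict inequalities required in \<open>Eset\<close>.\<close>

lemma subset_increments_chain:
  fixes x :: "real \<Rightarrow> 'x::ab_group_add"
  assumes "\<And>k. k < N \<Longrightarrow> w k \<le> w (Suc k)"
  shows "\<exists>n t. (\<Sum>k<N. if k \<in> A then x (w (Suc k)) - x (w k) else 0) =
            (\<Sum>i<n. x (t (2*i+1)) - x (t (2*i))) \<and>
          (\<forall>i<2*n-1. t i < t (Suc i)) \<and> (n \<ge> 1 \<longrightarrow> w 0 \<le> t 0 \<and> t (2*n-1) \<le> (w N :: real))"
  using assms
proof (induction N)
  case 0
  show ?case by (intro exI[of _ 0]) auto
next
  case (Suc N)
  then obtain n t where nt: "(\<Sum>k<N. if k \<in> A then x (w (Suc k)) - x (w k) else 0) =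
            (\<Sum>i<n. x (t (2*i+1)) - x (t (2*i)))"
          "\<forall>i<2*n-1. t i < t (Suc i)" "n \<ge> 1 \<longrightarrow> w 0 \<le> t 0 \<and> t (2*n-1) \<le> w N"
    by (meson less_Suc_eq)
  have le: "w N \<le> w (Suc N)" "w 0 \<le> w N"
    using Suc.prems nondecreasing_prefix[of "Suc N" w 0 N] by auto
  consider "N \<notin> A \<or> w N = w (Suc N)" | "N \<in> A" "w N < w (Suc N)" "n = 0"
    | m where "N \<in> A" "w N < w (Suc N)" "n = Suc m" "t (2*n-1) = w N"
    | m where "N \<in> A" "w N < w (Suc N)" "n = Suc m" "t (2*n-1) < w N"
  proof -
    assume R: "N \<notin> A \<or> w N = w (Suc N) \<Longrightarrow> thesis" "N \<in> A \<Longrightarrow> w N < w (Suc N) \<Longrightarrow> n = 0 \<Longrightarrow> thesis"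
      "\<And>m. N \<in> A \<Longrightarrow> w N < w (Suc N) \<Longrightarrow> n = Suc m \<Longrightarrow> t (2*n-1) = w N \<Longrightarrow> thesis"
      "\<And>m. N \<in> A \<Longrightarrow> w N < w (Suc N) \<Longrightarrow> n = Suc m \<Longrightarrow> t (2*n-1) < w N \<Longrightarrow> thesis"
    show thesis
    proof (cases "N \<notin> A \<or> w N = w (Suc N)")
      case False
      then have A: "N \<in> A" "w N < w (Suc N)" using le by auto
      show ?thesis
      proof (cases n)
        case (Suc m)
        then have "t (2*n-1) \<le> w N" using nt(3) by simp
        then show ?thesis using R(3,4)[OF A Suc] by linarith
      qed (use R(2) A in simp)
    qed (use R(1) in simp)
  qed
  then show ?case
  proof cases
    case 1
    then show ?thesis using nt le by (intro exI[of _ n] exI[of _ t]) auto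
  next
    case 2
    then show ?thesis using nt le
      by (intro exI[of _ 1] exI[of _ "\<lambda>i. if i = 0 then w N else w (Suc N)"]) auto
  next
    case 3
    \<comment> \<open>Merging: index \<open>2*m+1\<close>, which is \<open>2*n-1\<close>, holds the
      right end of the last interval, and only this point moves.\<close>
    define t' where "t' = t(2*m+1 := w (Suc N))"
    have "(\<Sum>i<m. x (t' (2*i+1)) - x (t' (2*i))) = (\<Sum>i<m. x (t (2*i+1)) - x (t (2*i)))"
    proof (rule sum.cong)
      fix i assume "i \<in> {..<m}"
      then have "2*i+1 \<noteq> 2*m+1" "2*i \<noteq> 2*m+1" by auto
      then show "x (t' (2*i+1)) - x (t' (2*i)) = x (t (2*i+1)) - x (t (2*i))"
        by (simp add: t'_def)
    qed simp
    then have "(\<Sum>k<Suc N. if k \<in> A then x (w (Suc k)) - x (w k) else 0) =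
        (\<Sum>i<n. x (t' (2*i+1)) - x (t' (2*i)))"
      using 3 nt(1) by (simp add: t'_def)
    moreover have "t' i < t' (Suc i)" if "i < 2*n-1" for i
      using that nt(2) 3 le by (cases "i = 2*m") (auto simp: t'_def less_trans)
    ultimately show ?thesis
      using nt(3) 3 le by (intro exI[of _ n] exI[of _ t']) (auto simp: t'_def)
  next
    case 4
    define t' where "t' = t(2*n := w N, 2*n+1 := w (Suc N))"
    have "(\<Sum>i<n. x (t' (2*i+1)) - x (t' (2*i))) = (\<Sum>i<n. x (t (2*i+1)) - x (t (2*i)))"
      by (rule sum.cong) (auto simp: t'_def)
    then have "(\<Sum>k<Suc N. if k \<in> A then x (w (Suc k)) - x (w k) else 0) =
        (\<Sum>i<Suc n. x (t' (2*i+1)) - x (t' (2*i)))"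
      using 4 nt(1) by (simp add: t'_def)
    moreover have "t' i < t' (Suc i)" if i: "i < 2 * Suc n - 1" for i
    proof -
      have "i < 2*n-1 \<or> i = 2*n-1 \<or> i = 2*n" using i by arith
      then consider "i < 2*n-1" | "i = 2*n-1" | "i = 2*n" by blast
      then show ?thesis
        using nt(2) 4 by cases (auto simp: t'_def)
    qed
    ultimately show ?thesis
      using nt(3) 4 le by (intro exI[of _ "Suc n"] exI[of _ t']) (auto simp: t'_def)
  qed
qed

text \<open>The value 0 accounts for selections in which no nondegenerate interval survives, because
  \<open>Eset\<close> requires \<open>n \<ge> 1\<close>.\<close>

lemma subset_increments_Eset:
  fixes x :: "real \<Rightarrow> 'x::ab_group_add"
  assumes "\<And>k. k < N \<Longrightarrow> w k \<le> w (Suc k)" "a \<le> w 0" "w N \<le> b"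
  shows "(\<Sum>k<N. if k \<in> A then x (w (Suc k)) - x (w k) else 0) \<in> insert 0 (Eset x a b)"
proof -
  obtain n t where nt: "(\<Sum>k<N. if k \<in> A then x (w (Suc k)) - x (w k) else 0) =
            (\<Sum>i<n. x (t (2*i+1)) - x (t (2*i)))"
          "\<forall>i<2*n-1. t i < t (Suc i)" "n \<ge> 1 \<longrightarrow> w 0 \<le> t 0 \<and> t (2*n-1) \<le> w N"
    using subset_increments_chain[of N w A x, OF assms(1)] by blast
  show ?thesis
  proof (cases "n = 0")
    case False
    then have "(\<Sum>i<n. x (t (2*i+1)) - x (t (2*i))) \<in> Eset x a b"
      unfolding Eset_def using nt(2,3) assms(2,3) by force
    then show ?thesis using nt(1) by simp
  qed (use nt(1) in simp)
qed

text \<open>The remainders follow the doubling map \<open>R\<close>, with digit 1 when the remainder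
  is at least \<open>1/2\<close>. Keeping the remainder in the equation gives an explicit error;
  allowing it to be 1 includes \<open>c = 1\<close>, whose digits are all 1.\<close>

lemma binary_expansion:
  fixes c :: real
  assumes "0 \<le> c" "c \<le> 1"
  shows "\<exists>d r. \<forall>n. 0 \<le> r n \<and> r n \<le> 1 \<and> c = (\<Sum>i<n. if d i then (1/2) ^ Suc i else 0) + (1/2) ^ n * r n"
proof -
  define R where "R = rec_nat c (\<lambda>_ r. if r \<ge> 1/2 then 2 * r - 1 else 2 * r)"
  have R: "R 0 = c" "R (Suc n) = (if R n \<ge> 1/2 then 2 * R n - 1 else 2 * R n)" for n
    by (simp_all add: R_def)
  have "0 \<le> R n \<and> R n \<le> 1" for n
    by (induction n) (use assms in \<open>auto simp: R\<close>)
  moreover have "c = (\<Sum>i<n. if R i \<ge> 1/2 then (1/2) ^ Suc i else 0) + (1/2) ^ n * R n" for n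
    by (induction n) (auto simp: R algebra_simps diff_divide_distrib)
  ultimately show ?thesis
    by (intro exI[of _ "\<lambda>i. R i \<ge> 1/2"] exI[of _ R]) blast
qed

section \<open>Clamping and the common refinement of two divisions\<close>

definition clamp_to :: "real \<Rightarrow> real \<Rightarrow> real \<Rightarrow> real" where
  "clamp_to l h v = max l (min v h)"

lemma clamp_to_mono: "v \<le> v' \<Longrightarrow> clamp_to l h v \<le> clamp_to l h v'"
  by (auto simp: clamp_to_def)

text \<open>A nondegenerate cell of the refinement thus comes from two intervals that meet, which
  forces their tags to be close.\<close>

lemma clamp_to_neq: "l \<le> h \<Longrightarrow> v \<le> v' \<Longrightarrow> clamp_to l h v \<noteq> clamp_to l h v' \<Longrightarrow> v \<le> h \<and> l \<le> v'"
  by (auto simp: clamp_to_def min_def max_def split: if_splits)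

text \<open>Intervals left of \<open>v\<close> contribute their full increment, those right of
  \<open>v\<close> nothing, and the one containing \<open>v\<close> the part up to
  \<open>v\<close>.\<close>

lemma sum_clamp_telescope:
  fixes x :: "real \<Rightarrow> 'x::ab_group_add"
  assumes "\<And>i. i < n \<Longrightarrow> t i \<le> t (Suc i)" "t 0 \<le> v"
  shows "(\<Sum>i<n. x (clamp_to (t i) (t (Suc i)) v) - x (t i)) = x (min v (t n)) - x (t 0)"
  using assms
proof (induction n)
  case (Suc n)
  then have "t n \<le> t (Suc n)" "t 0 \<le> t n"
    using nondecreasing_prefix[of "Suc n" t 0 n] by auto
  then have "x (clamp_to (t n) (t (Suc n)) v) - x (t n) = x (min v (t (Suc n))) - x (min v (t n))"
    unfolding clamp_to_def by (cases "v \<le> t n") (auto simp: min_def max_def)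
  moreover have "(\<Sum>i<n. x (clamp_to (t i) (t (Suc i)) v) - x (t i)) = x (min v (t n)) - x (t 0)"
    using Suc by auto
  ultimately show ?case by simp
qed simp

lemma tagged_div_bounds:
  assumes "tagged_div a b n t s" "i < n"
  shows "a \<le> t i" "t (Suc i) \<le> b" "t i \<le> t (Suc i)" "t i \<le> s (Suc i)" "s (Suc i) \<le> t (Suc i)"
  using assms nondecreasing_prefix[of n t 0 i] nondecreasing_prefix[of n t "Suc i" n]
  by (auto simp: tagged_div_def)

text \<open>The common refinement of two divisions: \<open>i * m + j\<close> is sent to the point \<open>u j\<close> clamped to the
  \<open>i\<close>-th interval of the first division.\<close>

definition refinement :: "nat \<Rightarrow> (nat \<Rightarrow> real) \<Rightarrow> nat \<Rightarrow> (nat \<Rightarrow> real) \<Rightarrow> nat \<Rightarrow> real" where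
  "refinement n t m u k = (if k < n * m
     then clamp_to (t (k div m)) (t (Suc (k div m))) (u (k mod m)) else t n)"

lemma refinement_step:
  assumes t: "tagged_div a b n t s" and u: "tagged_div a b m u r" and "i < n" "j < m"
  shows "refinement n t m u (i * m + j) = clamp_to (t i) (t (Suc i)) (u j)"
    and "refinement n t m u (Suc (i * m + j)) = clamp_to (t i) (t (Suc i)) (u (Suc j))"
proof -
  have lt: "i * m + j < n * m"
    using \<open>i < n\<close> \<open>j < m\<close> by (metis add_less_cancel_left less_le_trans mult_Suc mult_le_mono1 Suc_leI add.commute)
  show "refinement n t m u (i * m + j) = clamp_to (t i) (t (Suc i)) (u j)"
    using lt \<open>j < m\<close> by (simp add: refinement_def)
  show "refinement n t m u (Suc (i * m + j)) = clamp_to (t i) (t (Suc i)) (u (Suc j))"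
  \<comment> \<open>At the end of row \<open>i\<close> the successor index starts the next row. Both
    descriptions agree there: clamping \<open>b\<close> to the \<open>i\<close>-th interval and
    \<open>a\<close> to the following one both give \<open>t (Suc i)\<close>; after the last row the
    default value \<open>t n\<close> of \<open>refinement\<close> takes over.\<close>
  proof (cases "Suc j = m")
    case True
    have um: "u (Suc j) = b" "u 0 = a" using u True by (auto simp: tagged_div_def)
    have eq: "Suc (i * m + j) = Suc i * m" using True by simp
    have "clamp_to (t i) (t (Suc i)) b = t (Suc i)"
      using tagged_div_bounds[OF t \<open>i < n\<close>] by (simp add: clamp_to_def)
    moreover have "refinement n t m u (Suc i * m) = t (Suc i)"
    proof (cases "Suc i < n")
      case True
      have "Suc i * m < n * m" using True \<open>j < m\<close> by (intro mult_less_mono1) auto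
      moreover have "Suc i * m div m = Suc i" "Suc i * m mod m = 0"
        using \<open>j < m\<close> by (simp_all only: nonzero_mult_div_cancel_right mod_mult_self2_is_0)
      ultimately show ?thesis
        using tagged_div_bounds[OF t True] um by (simp add: refinement_def clamp_to_def)
    next
      case False
      then have "Suc i = n" using \<open>i < n\<close> by simp
      then show ?thesis by (simp add: refinement_def)
    qed
    ultimately show ?thesis by (simp only: um eq)
  next
    case False
    then have "Suc j < m" using \<open>j < m\<close> by simp
    moreover from this have "i * m + Suc j < n * m"
      using \<open>i < n\<close> by (metis add_less_cancel_left less_le_trans mult_Suc mult_le_mono1 Suc_leI add.commute)
    ultimately show ?thesis
      by (simp add: refinement_def flip: add_Suc_right)
  qed
qed

lemma sum_block: "sum f {i * m ..< i * m + m} = (\<Sum>j<m. f (i * m + j))"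
  for f :: "nat \<Rightarrow> 'x::comm_monoid_add"
  by (simp add: sum.atLeastLessThan_shift_0[of f "i * m" "i * m + m"] atLeast0LessThan)

context complete_lcs
begin

text \<open>Within row \<open>i\<close> the tag is constant and the increments over the cells
  telescope to \<open>x (t (Suc i)) - x (t i)\<close>.\<close>

lemma rs_sum_refine_left:
  assumes t: "tagged_div a b n t s" and u: "tagged_div a b m u r"
  shows "rs_sum sm g x n t s =
    (\<Sum>k<n*m. sm (g (s (Suc (k div m)))) (x (refinement n t m u (Suc k)) - x (refinement n t m u k)))"
proof -
  have "sm (g (s (Suc i))) (x (t (Suc i)) - x (t i)) =
      (\<Sum>j<m. sm (g (s (Suc ((i*m+j) div m)))) (x (refinement n t m u (Suc (i*m+j))) - x (refinement n t m u (i*m+j))))"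
    if "i < n" for i
  proof -
    have "(\<Sum>j<m. sm (g (s (Suc ((i*m+j) div m)))) (x (refinement n t m u (Suc (i*m+j))) - x (refinement n t m u (i*m+j))))
        = (\<Sum>j<m. sm (g (s (Suc i))) (x (clamp_to (t i) (t (Suc i)) (u (Suc j))) - x (clamp_to (t i) (t (Suc i)) (u j))))"
      by (rule sum.cong) (simp_all add: refinement_step[OF t u that])
    also have "\<dots> = sm (g (s (Suc i))) (x (clamp_to (t i) (t (Suc i)) (u m)) - x (clamp_to (t i) (t (Suc i)) (u 0)))"
      using sum_lessThan_telescope[of "\<lambda>j. x (clamp_to (t i) (t (Suc i)) (u j))" m]
      by (simp flip: scale_sum_right)
    also have "\<dots> = sm (g (s (Suc i))) (x (t (Suc i)) - x (t i))"
      using tagged_div_bounds[OF t that] u by (simp add: clamp_to_def tagged_div_def)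
    finally show ?thesis by simp
  qed
  then show ?thesis
    unfolding rs_sum_def sum.nat_group[symmetric] sum_block by (intro sum.cong) auto
qed

text \<open>After exchanging the sums, the tag is constant for fixed \<open>j\<close>. The pieces of
  the \<open>j\<close>-th interval over all rows add up by \<open>sum_clamp_telescope\<close>, used
  at both endpoints and subtracted.\<close>

lemma rs_sum_refine_right:
  assumes t: "tagged_div a b n t s" and u: "tagged_div a b m u r"
  shows "rs_sum sm g x m u r =
    (\<Sum>k<n*m. sm (g (r (Suc (k mod m)))) (x (refinement n t m u (Suc k)) - x (refinement n t m u k)))"
proof -
  let ?c = "\<lambda>i j. x (clamp_to (t i) (t (Suc i)) (u j))"
  have *: "x (u (Suc j)) - x (u j) = (\<Sum>i<n. ?c i (Suc j) - ?c i j)" if "j < m" for j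
  proof -
    have tel: "(\<Sum>i<n. x (clamp_to (t i) (t (Suc i)) v) - x (t i)) = x v - x (t 0)" if "a \<le> v" "v \<le> b" for v
      using sum_clamp_telescope[of n t v x] t that by (auto simp: tagged_div_def)
    have "(\<Sum>i<n. ?c i (Suc j) - x (t i)) - (\<Sum>i<n. ?c i j - x (t i)) = x (u (Suc j)) - x (u j)"
      using tagged_div_bounds[OF u that] by (simp add: tel)
    then show ?thesis by (simp add: sum_subtractf)
  qed
  have "(\<Sum>k<n*m. sm (g (r (Suc (k mod m)))) (x (refinement n t m u (Suc k)) - x (refinement n t m u k)))
      = (\<Sum>i<n. \<Sum>j<m. sm (g (r (Suc j))) (?c i (Suc j) - ?c i j))"
    unfolding sum.nat_group[symmetric] sum_block
    by (intro sum.cong refl) (simp add: refinement_step[OF t u])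
  also have "\<dots> = (\<Sum>j<m. sm (g (r (Suc j))) (\<Sum>i<n. ?c i (Suc j) - ?c i j))"
    by (subst sum.swap) (simp add: scale_sum_right)
  also have "\<dots> = rs_sum sm g x m u r"
    unfolding rs_sum_def by (intro sum.cong refl) (simp add: *)
  finally show ?thesis by simp
qed

lemma refinement_nondecreasing:
  assumes t: "tagged_div a b n t s" and u: "tagged_div a b m u r" and k: "k < n * m"
  shows "refinement n t m u k \<le> refinement n t m u (Suc k)"
    and "refinement n t m u k \<noteq> refinement n t m u (Suc k) \<Longrightarrow>
      u (k mod m) \<le> t (Suc (k div m)) \<and> t (k div m) \<le> u (Suc (k mod m))"
proof -
  have "m > 0" using k by (cases m) auto
  then have ij: "k div m < n" "k mod m < m" using k by (auto simp: less_mult_imp_div_less)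
  have eqs: "refinement n t m u k = clamp_to (t (k div m)) (t (Suc (k div m))) (u (k mod m))"
    "refinement n t m u (Suc k) = clamp_to (t (k div m)) (t (Suc (k div m))) (u (Suc (k mod m)))"
    using refinement_step[OF t u ij] by (simp_all only: div_mult_mod_eq)
  note b = tagged_div_bounds[OF t ij(1)] tagged_div_bounds[OF u ij(2)]
  show "refinement n t m u k \<le> refinement n t m u (Suc k)"
    using b unfolding eqs by (simp add: clamp_to_mono)
  show "u (k mod m) \<le> t (Suc (k div m)) \<and> t (k div m) \<le> u (Suc (k mod m))"
    if "refinement n t m u k \<noteq> refinement n t m u (Suc k)"
    using b that unfolding eqs by (intro clamp_to_neq) auto
qed

text \<open>Coefficients in \<open>[0,1]\<close> are handled by dyadic digits. Splitting into
  positive and negative parts, then into real and imaginary parts, reduces complex coefficients of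
  modulus at most 1 to this case, and weak compactness survives the algebraic sums.\<close>

lemma weakly_compact_increment_sums:
  assumes x: "weakly_compact_semivariation sm P x a b"
  shows "\<exists>K. compactin W K \<and> (\<forall>N w c. (\<forall>k<N. w k \<le> w (Suc k)) \<longrightarrow> a \<le> w 0 \<longrightarrow> w N \<le> b \<longrightarrow>
      (\<forall>k<N. cmod (c k) \<le> 1) \<longrightarrow> (\<Sum>k<N. sm (c k) (x (w (Suc k)) - x (w k))) \<in> K)"
proof -
  define K where "K = insert 0 (W closure_of Eset x a b)"
  have K: "compactin W K"
    using compactin_Un[of W "{0}" "W closure_of Eset x a b"] x
    by (simp add: K_def weakly_compact_semivariation_def)
  have "Eset x a b \<subseteq> W closure_of Eset x a b" by (simp add: closure_of_subset)
  then have E: "insert 0 (Eset x a b) \<subseteq> K" by (auto simp: K_def)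
  obtain L where L: "compactin W L"
    "\<And>e z. range e \<subseteq> K \<Longrightarrow> lc_limit (\<lambda>n. \<Sum>i<n. sm ((1/2) ^ Suc i) (e i)) z \<Longrightarrow> z \<in> L"
    using weakly_compact_dyadic_series[OF K] by blast
  have unit: "(\<Sum>k<N. sm (of_real (c k)) (x (w (Suc k)) - x (w k))) \<in> L"
    if w: "\<And>k. k < N \<Longrightarrow> w k \<le> w (Suc k)" "a \<le> w 0" "w N \<le> b"
      and c: "\<And>k. k < N \<Longrightarrow> 0 \<le> c k \<and> c k \<le> 1" for N :: nat and w c
  proof -
    define D where "D k = x (w (Suc k)) - x (w k)" for k
    define digits where "digits k d r \<longleftrightarrow> (\<forall>n. 0 \<le> r n \<and> r n \<le> 1 \<and>
        c k = (\<Sum>i<n. if d i then (1/2) ^ Suc i else 0) + (1/2) ^ n * r n)" for k d and r :: "nat \<Rightarrow> real"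
    have "\<exists>d r. digits k d r" if "k < N" for k
      unfolding digits_def using c[OF that] by (intro binary_expansion) auto
    then obtain d r where "\<And>k. k < N \<Longrightarrow> digits k (d k) (r k)" by metis
    then have dr: "\<And>k n. k < N \<Longrightarrow> 0 \<le> r k n \<and> r k n \<le> 1 \<and>
        c k = (\<Sum>i<n. if d k i then (1/2) ^ Suc i else 0) + (1/2) ^ n * r k n"
      by (simp add: digits_def)
    \<comment> \<open>The increments whose coefficient has \<open>i\<close>-th binary digit 1. If
      there are none, the sum is 0, which is why \<open>K\<close> contains 0.\<close>
    define e where "e i = (\<Sum>k<N. if k \<in> {k. d k i} then D k else 0)" for i
    have "range e \<subseteq> K"
      using subset_increments_Eset[of N w a b _ x, OF w] E unfolding e_def D_def by blast
    moreover have "lc_limit (\<lambda>n. \<Sum>i<n. sm ((1/2) ^ Suc i) (e i)) (\<Sum>k<N. sm (of_real (c k)) (D k))"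
      unfolding lc_limit_def
    proof
      fix p assume p: "p \<in> P"
      note sem = seminorm_P[OF p]
      define B where "B = (\<Sum>k<N. p (D k))"
      have bd: "norm (p ((\<Sum>i<n. sm ((1/2) ^ Suc i) (e i)) - (\<Sum>k<N. sm (of_real (c k)) (D k)))) \<le> (1/2) ^ n * B" for n
      proof -
        have "(\<Sum>i<n. sm ((1/2) ^ Suc i) (e i)) =
            (\<Sum>k<N. \<Sum>i<n. sm ((1/2) ^ Suc i) (if d k i then D k else 0))"
          unfolding e_def scale_sum_right mem_Collect_eq by (rule sum.swap)
        also have "\<dots> = (\<Sum>k<N. sm (\<Sum>i<n. if d k i then (1/2) ^ Suc i else 0) (D k))"
          unfolding scale_sum_left by (intro sum.cong refl) simp
        also have "\<dots> = (\<Sum>k<N. sm (of_real (c k)) (D k) - sm (of_real ((1/2) ^ n * r k n)) (D k))"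
        proof (intro sum.cong refl)
          fix k assume "k \<in> {..<N}"
          then have "(\<Sum>i<n. if d k i then (1/2) ^ Suc i else 0) = c k - (1/2) ^ n * r k n"
            using dr[of k n] by simp
          then have "of_real (\<Sum>i<n. if d k i then (1/2) ^ Suc i else 0) =
              (of_real (c k) - of_real ((1/2) ^ n * r k n) :: complex)" by (simp only: of_real_diff)
          moreover have "of_real (\<Sum>i<n. if d k i then (1/2) ^ Suc i else 0) =
              (\<Sum>i<n. if d k i then (1/2) ^ Suc i else 0 :: complex)"
            unfolding of_real_sum by (intro sum.cong refl) simp
          ultimately show "sm (\<Sum>i<n. if d k i then (1/2) ^ Suc i else 0) (D k) =
              sm (of_real (c k)) (D k) - sm (of_real ((1/2) ^ n * r k n)) (D k)"
            by (simp only: scale_left_diff_distrib)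
        qed
        finally have "(\<Sum>i<n. sm ((1/2) ^ Suc i) (e i)) - (\<Sum>k<N. sm (of_real (c k)) (D k)) =
            - (\<Sum>k<N. sm (of_real ((1/2) ^ n * r k n)) (D k))"
          by (simp add: sum_subtractf)
        then have "p ((\<Sum>i<n. sm ((1/2) ^ Suc i) (e i)) - (\<Sum>k<N. sm (of_real (c k)) (D k))) =
            p (\<Sum>k<N. sm (of_real ((1/2) ^ n * r k n)) (D k))"
          by (simp only: seminorm_minus[OF sem])
        also have "\<dots> \<le> (\<Sum>k<N. p (sm (of_real ((1/2) ^ n * r k n)) (D k)))"
          by (rule seminorm_sum[OF sem])
        also have "\<dots> = (\<Sum>k<N. (1/2) ^ n * r k n * p (D k))"
          by (intro sum.cong refl) (use dr in \<open>simp add: seminorm_scale[OF sem] norm_mult norm_power norm_divide\<close>)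
        also have "\<dots> \<le> (\<Sum>k<N. (1/2) ^ n * p (D k))"
          using dr seminorm_nonneg[OF sem]
          by (intro sum_mono) (simp add: mult_left_le_one_le mult.assoc)
        also have "\<dots> = (1/2) ^ n * B" by (simp add: B_def sum_distrib_left)
        finally show ?thesis using seminorm_nonneg[OF sem] by simp
      qed
      have "(\<lambda>n. (1/2) ^ n * B) \<longlonglongrightarrow> 0"
        by (intro tendsto_mult_left_zero LIMSEQ_power_zero) simp
      then show "(\<lambda>n. p ((\<Sum>i<n. sm ((1/2) ^ Suc i) (e i)) - (\<Sum>k<N. sm (of_real (c k)) (D k)))) \<longlonglongrightarrow> 0"
        by (rule Lim_null_comparison[OF always_eventually[OF allI[OF bd]]])
    qed
    ultimately show ?thesis using L(2) unfolding D_def by blast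
  qed
  define M where "M = {y + z | y z. y \<in> L \<and> z \<in> sm (-1) ` L}"
  define K' where "K' = {y + z | y z. y \<in> M \<and> z \<in> sm \<i> ` M}"
  have M: "compactin W M"
    unfolding M_def by (intro compactin_weak_add compactin_weak_scale L(1))
  have "compactin W K'"
    unfolding K'_def by (intro compactin_weak_add compactin_weak_scale M)
  moreover have "(\<Sum>k<N. sm (c k) (x (w (Suc k)) - x (w k))) \<in> K'"
    if w: "\<forall>k<N. w k \<le> w (Suc k)" "a \<le> w 0" "w N \<le> b" and c: "\<forall>k<N. cmod (c k) \<le> 1" for N w c
  proof -
    have real: "(\<Sum>k<N. sm (of_real (h k)) (x (w (Suc k)) - x (w k))) \<in> M"
      if h: "\<And>k. k < N \<Longrightarrow> \<bar>h k\<bar> \<le> 1" for h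
    proof -
      have split: "of_real (h k) = of_real (max 0 (h k)) + (-1) * (of_real (max 0 (- h k)) :: complex)" for k
        by (simp add: max_def)
      have "(\<Sum>k<N. sm (of_real (h k)) (x (w (Suc k)) - x (w k))) =
          (\<Sum>k<N. sm (of_real (max 0 (h k))) (x (w (Suc k)) - x (w k))) +
          sm (-1) (\<Sum>k<N. sm (of_real (max 0 (- h k))) (x (w (Suc k)) - x (w k)))"
        unfolding scale_sum_right sum.distrib[symmetric] scale_scale
        by (subst split) (simp only: scale_left_distrib)
      moreover have "(\<Sum>k<N. sm (of_real (max 0 (h k))) (x (w (Suc k)) - x (w k))) \<in> L"
        using w h by (intro unit) (auto simp: abs_le_iff)
      moreover have "(\<Sum>k<N. sm (of_real (max 0 (- h k))) (x (w (Suc k)) - x (w k))) \<in> L"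
        using w h by (intro unit) (auto simp: abs_le_iff minus_le_iff)
      ultimately show ?thesis unfolding M_def by blast
    qed
    have split: "c k = of_real (Re (c k)) + \<i> * of_real (Im (c k))" for k
      by (simp add: complex_eq)
    have "(\<Sum>k<N. sm (c k) (x (w (Suc k)) - x (w k))) =
        (\<Sum>k<N. sm (of_real (Re (c k))) (x (w (Suc k)) - x (w k))) +
        sm \<i> (\<Sum>k<N. sm (of_real (Im (c k))) (x (w (Suc k)) - x (w k)))"
      unfolding scale_sum_right sum.distrib[symmetric] scale_scale
      by (subst split) (simp only: scale_left_distrib)
    moreover have "(\<Sum>k<N. sm (of_real (Re (c k))) (x (w (Suc k)) - x (w k))) \<in> M"
      using c abs_Re_le_cmod order_trans by (intro real) blast
    moreover have "(\<Sum>k<N. sm (of_real (Im (c k))) (x (w (Suc k)) - x (w k))) \<in> M"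
      using c abs_Im_le_cmod order_trans by (intro real) blast
    ultimately show ?thesis unfolding K'_def by blast
  qed
  ultimately show ?thesis by blast
qed

end

section \<open>From semivariation to weakly compact maps\<close>

lemma CAB_add: "g \<in> CAB a b \<Longrightarrow> h \<in> CAB a b \<Longrightarrow> (\<lambda>t. g t + h t) \<in> CAB a b"
  by (auto simp: CAB_def intro: continuous_intros)

lemma CAB_scale: "g \<in> CAB a b \<Longrightarrow> (\<lambda>t. c * g t) \<in> CAB a b"
  by (auto simp: CAB_def intro: continuous_intros)

lemma CAB_norm_le_supnorm:
  assumes "g \<in> CAB a b" "t \<in> {a..b}"
  shows "cmod (g t) \<le> supnorm a b g"
  unfolding supnorm_def
proof (rule cSUP_upper[OF assms(2)])
  have "compact ((\<lambda>t. cmod (g t)) ` {a..b})"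
    using assms(1) by (intro compact_continuous_image continuous_intros) (auto simp: CAB_def)
  then show "bdd_above ((\<lambda>t. cmod (g t)) ` {a..b})"
    by (simp add: bounded_imp_bdd_above compact_imp_bounded)
qed

lemma CAB_uniformly_continuous:
  assumes "g \<in> CAB a b" "e > 0"
  shows "\<exists>d>0. \<forall>s\<in>{a..b}. \<forall>t\<in>{a..b}. \<bar>s - t\<bar> < d \<longrightarrow> cmod (g s - g t) \<le> e"
proof -
  have "uniformly_continuous_on {a..b} g"
    using assms(1) by (intro compact_uniformly_continuous) (auto simp: CAB_def)
  then obtain d where d: "d > 0" "\<forall>t\<in>{a..b}. \<forall>s\<in>{a..b}. dist s t < d \<longrightarrow> dist (g s) (g t) < e"
    using assms(2) unfolding uniformly_continuous_on_def by blast
  have "cmod (g s - g t) \<le> e" if "s \<in> {a..b}" "t \<in> {a..b}" "\<bar>s - t\<bar> < d" for s t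
    using d(2) that by (fastforce simp: dist_norm)
  then show ?thesis using d(1) by blast
qed

context complete_lcs
begin

text \<open>A neighbourhood of \<open>I\<close> contains a finite intersection of seminorm balls, so
  the smallest of finitely many mesh bounds works.\<close>

lemma has_rs_integralI:
  assumes "\<And>p e. p \<in> P \<Longrightarrow> e > 0 \<Longrightarrow> \<exists>\<delta>>0. \<forall>n t s. tagged_div a b n t s \<and> (\<forall>i<n. t (Suc i) - t i < \<delta>)
              \<longrightarrow> p (rs_sum sm g x n t s - I) < e"
  shows "has_rs_integral sm P a b g x I"
  unfolding has_rs_integral_def
proof (intro allI impI, elim conjE)
  fix U assume U: "openin (lc_top P) U" "I \<in> U"
  obtain Q e where Q: "finite Q" "Q \<subseteq> P" "e > 0" "{y. \<forall>p\<in>Q. p (y - I) < e} \<subseteq> U"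
    using openin_lc_topD[OF U] by blast
  define small where "small p \<delta> \<longleftrightarrow> (\<forall>n t s. tagged_div a b n t s \<and> (\<forall>i<n. t (Suc i) - t i < \<delta>)
              \<longrightarrow> p (rs_sum sm g x n t s - I) < e)" for p :: "'x \<Rightarrow> real" and \<delta>
  have mono: "small p \<delta>'" if "small p \<delta>" "\<delta>' \<le> \<delta>" for p \<delta> \<delta>'
    using that unfolding small_def by (meson less_le_trans)
  have "\<exists>\<delta>>0. \<forall>p\<in>Q. small p \<delta>"
    using Q(1,2)
  proof (induction Q rule: finite_induct)
    case empty
    show ?case by (intro exI[of _ 1]) simp
  next
    case (insert q Q)
    then obtain \<delta>1 where d1: "\<delta>1 > 0" "\<forall>p\<in>Q. small p \<delta>1" by auto
    obtain \<delta>2 where d2: "\<delta>2 > 0" "small q \<delta>2"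
      using assms[of q e] insert.prems \<open>e > 0\<close> by (auto simp: small_def)
    show ?case
      using d1 d2 mono by (intro exI[of _ "min \<delta>1 \<delta>2"]) auto
  qed
  then obtain \<delta> where d: "\<delta> > 0" "\<And>p. p \<in> Q \<Longrightarrow> small p \<delta>" by blast
  show "\<exists>\<delta>>0. \<forall>n t s. tagged_div a b n t s \<and> (\<forall>i<n. t (Suc i) - t i < \<delta>) \<longrightarrow> rs_sum sm g x n t s \<in> U"
    using d Q(4) unfolding small_def by (intro exI[of _ \<delta>]) auto
qed

text \<open>Coefficients are constrained only where \<open>w k \<noteq> w (Suc k)\<close>: on
  degenerate cells of a refinement the tags may be far apart, but the increment is 0, so the proof
  replaces those coefficients by 0.\<close>

lemma increment_sums_bound:
  assumes x: "weakly_compact_semivariation sm P x a b" and p: "p \<in> P"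
  shows "\<exists>C\<ge>0. \<forall>N w c M. (\<forall>k<N. w k \<le> w (Suc k)) \<longrightarrow> a \<le> w 0 \<longrightarrow> w N \<le> b \<longrightarrow> M > 0 \<longrightarrow>
      (\<forall>k<N. w k \<noteq> w (Suc k) \<longrightarrow> cmod (c k) \<le> M) \<longrightarrow>
      p (\<Sum>k<N. sm (c k) (x (w (Suc k)) - x (w k))) \<le> M * C"
proof -
  obtain K where K: "compactin W K" "\<And>N w c. \<forall>k<N. w k \<le> w (Suc k) \<Longrightarrow> a \<le> w 0 \<Longrightarrow> w N \<le> b \<Longrightarrow>
      \<forall>k<N. cmod (c k) \<le> 1 \<Longrightarrow> (\<Sum>k<N. sm (c k) (x (w (Suc k)) - x (w k))) \<in> K"
    using weakly_compact_increment_sums[OF x] by blast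
  obtain B where B: "\<And>z. z \<in> K \<Longrightarrow> p z \<le> B"
    using weakly_compact_imp_bounded[OF p K(1)] by blast
  have "p (\<Sum>k<N. sm (c k) (x (w (Suc k)) - x (w k))) \<le> M * max 0 B"
    if w: "\<forall>k<N. w k \<le> w (Suc k)" "a \<le> w 0" "w N \<le> b" and M: "M > 0"
      and c: "\<forall>k<N. w k \<noteq> w (Suc k) \<longrightarrow> cmod (c k) \<le> M" for N w c M
  proof -
    define c' where "c' k = (if w k = w (Suc k) then 0 else c k / of_real M)" for k
    have "\<forall>k<N. cmod (c' k) \<le> 1"
      using c M by (auto simp: c'_def norm_divide)
    then have "p (\<Sum>k<N. sm (c' k) (x (w (Suc k)) - x (w k))) \<le> max 0 B"
      using B[OF K(2)[OF w]] by fastforce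
    moreover have "(\<Sum>k<N. sm (c k) (x (w (Suc k)) - x (w k))) =
        sm (of_real M) (\<Sum>k<N. sm (c' k) (x (w (Suc k)) - x (w k)))"
      unfolding scale_sum_right using M by (intro sum.cong) (auto simp: c'_def)
    ultimately show ?thesis
      using M by (simp add: seminorm_scale[OF seminorm_P[OF p]] mult_left_mono)
  qed
  then show ?thesis by (intro exI[of _ "max 0 B"]) auto
qed

text \<open>Over the common refinement the difference of the two sums is a single increment sum with
  coefficients \<open>g (s ..) - g (r ..)\<close>. On nondegenerate cells the intervals carrying the
  tags meet, and both are shorter than \<open>d / 2\<close>, so the tags differ by less than
  \<open>d\<close>.\<close>

lemma rs_sum_cauchy:
  assumes x: "weakly_compact_semivariation sm P x a b" and p: "p \<in> P"
    and g: "g \<in> CAB a b" and e: "e > 0"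
  shows "\<exists>\<delta>>0. \<forall>n t s m u r. tagged_div a b n t s \<longrightarrow> (\<forall>i<n. t (Suc i) - t i < \<delta>) \<longrightarrow>
    tagged_div a b m u r \<longrightarrow> (\<forall>i<m. u (Suc i) - u i < \<delta>) \<longrightarrow>
    p (rs_sum sm g x n t s - rs_sum sm g x m u r) < e"
proof -
  obtain C where C: "C \<ge> 0" "\<And>N w c M. \<forall>k<N. w k \<le> w (Suc k) \<Longrightarrow> a \<le> w 0 \<Longrightarrow> w N \<le> b \<Longrightarrow> M > 0 \<Longrightarrow>
      \<forall>k<N. w k \<noteq> w (Suc k) \<longrightarrow> cmod (c k) \<le> M \<Longrightarrow>
      p (\<Sum>k<N. sm (c k) (x (w (Suc k)) - x (w k))) \<le> M * C"
    using increment_sums_bound[OF x p] by blast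
  \<comment> \<open>Adding 1 keeps the denominator positive when \<open>C = 0\<close> and yields the
    strict bound \<open>M * C < e\<close>.\<close>
  define M where "M = e / (C + 1)"
  have M: "M > 0" "M * C < e"
    using e C(1) by (auto simp: M_def field_simps)
  obtain d where d: "d > 0" "\<And>s t. s \<in> {a..b} \<Longrightarrow> t \<in> {a..b} \<Longrightarrow> \<bar>s - t\<bar> < d \<Longrightarrow> cmod (g s - g t) \<le> M"
    using CAB_uniformly_continuous[OF g M(1)] by blast
  have "p (rs_sum sm g x n t s - rs_sum sm g x m u r) < e"
    if t: "tagged_div a b n t s" and tm: "\<forall>i<n. t (Suc i) - t i < d / 2"
      and u: "tagged_div a b m u r" and um: "\<forall>i<m. u (Suc i) - u i < d / 2" for n t s m u r
  proof -
    let ?w = "refinement n t m u"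
    have "rs_sum sm g x n t s - rs_sum sm g x m u r =
        (\<Sum>k<n*m. sm (g (s (Suc (k div m))) - g (r (Suc (k mod m)))) (x (?w (Suc k)) - x (?w k)))"
      unfolding rs_sum_refine_left[OF t u] rs_sum_refine_right[OF t u]
      by (simp add: sum_subtractf scale_left_diff_distrib)
    also have "p \<dots> \<le> M * C"
    proof (rule C(2))
      show "\<forall>k<n*m. ?w k \<le> ?w (Suc k)"
        using refinement_nondecreasing(1)[OF t u] by blast
      show "a \<le> ?w 0"
      proof (cases "n * m = 0")
        case True
        have "t 0 \<le> t n" using t by (intro nondecreasing_prefix[of n t 0 n]) (auto simp: tagged_div_def)
        then show ?thesis using True t by (auto simp: refinement_def tagged_div_def)
      next
        case False
        then have "0 < n" by auto
        then show ?thesis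
          using False tagged_div_bounds(1)[OF t \<open>0 < n\<close>] by (auto simp: refinement_def clamp_to_def)
      qed
      show "?w (n * m) \<le> b" using t by (simp add: refinement_def tagged_div_def)
      show "\<forall>k<n*m. ?w k \<noteq> ?w (Suc k) \<longrightarrow> cmod (g (s (Suc (k div m))) - g (r (Suc (k mod m)))) \<le> M"
      proof (intro allI impI)
        fix k assume k: "k < n * m" and ne: "?w k \<noteq> ?w (Suc k)"
        have "m > 0" using k by (cases m) auto
        then have ij: "k div m < n" "k mod m < m" using k by (auto simp: less_mult_imp_div_less)
        note bt = tagged_div_bounds[OF t ij(1)] and bu = tagged_div_bounds[OF u ij(2)]
        have "u (k mod m) \<le> t (Suc (k div m))" "t (k div m) \<le> u (Suc (k mod m))"
          using refinement_nondecreasing(2)[OF t u k ne] by auto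
        moreover have "t (Suc (k div m)) - t (k div m) < d / 2" "u (Suc (k mod m)) - u (k mod m) < d / 2"
          using tm um ij by auto
        ultimately have "s (Suc (k div m)) - r (Suc (k mod m)) < d" "r (Suc (k mod m)) - s (Suc (k div m)) < d"
          using bt bu by linarith+
        then show "cmod (g (s (Suc (k div m))) - g (r (Suc (k mod m)))) \<le> M"
          using bt bu by (intro d(2)) auto
      qed
    qed (rule M(1))
    finally show ?thesis using M(2) by simp
  qed
  then show ?thesis using d(1) by (intro exI[of _ "d / 2"]) auto
qed

text \<open>There are \<open>Suc n\<close> cells, so the divisor is never 0. The same function also
  serves as the tag function: tags are indexed from \<open>Suc 0\<close>, so the tags are the right
  endpoints.\<close>

definition uniform_div :: "real \<Rightarrow> real \<Rightarrow> nat \<Rightarrow> nat \<Rightarrow> real" where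
  "uniform_div a b n i = a + real i * ((b - a) / real (Suc n))"

lemma uniform_div_tagged:
  assumes "a < b"
  shows "tagged_div a b (Suc n) (uniform_div a b n) (uniform_div a b n)"
    and "uniform_div a b n (Suc i) - uniform_div a b n i = (b - a) / real (Suc n)"
proof -
  have "a + real (Suc i) * h - (a + real i * h) = h" for h i
    by (simp add: algebra_simps)
  then show *: "uniform_div a b n (Suc i) - uniform_div a b n i = (b - a) / real (Suc n)" for i
    unfolding uniform_div_def .
  have "(b - a) / real (Suc n) \<ge> 0" using assms by simp
  then have "uniform_div a b n i \<le> uniform_div a b n (Suc i)" for i
    using *[of i] by linarith
  then show "tagged_div a b (Suc n) (uniform_div a b n) (uniform_div a b n)"
    by (simp add: tagged_div_def) (simp add: uniform_div_def)
qed

lemma uniform_div_fine: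
  assumes "\<delta> > 0"
  shows "\<forall>\<^sub>F n in sequentially. (b - a) / real (Suc n) < \<delta>"
proof -
  have "(\<lambda>n. (b - a) / real (Suc n)) \<longlonglongrightarrow> 0"
    using LIMSEQ_Suc[OF lim_const_over_n[of "b - a"]] by simp
  then show ?thesis using assms by (rule order_tendstoD)
qed

text \<open>\<open>T g\<close> is constructed as the limit along uniform divisions, from which
  linearity passes directly. The Cauchy estimate then compares an arbitrary fine division with a
  single uniform one.\<close>

theorem semivariation_imp_weakly_compact:
  assumes x: "weakly_compact_semivariation sm P x a b" and "a < b"
  shows "\<exists>T. (\<forall>g\<in>CAB a b. has_rs_integral sm P a b g x (T g)) \<and> weakly_compact_linear sm P a b T"
proof -
  define U where "U g n = rs_sum sm g x (Suc n) (uniform_div a b n) (uniform_div a b n)" for g n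
  note div = uniform_div_tagged[OF \<open>a < b\<close>]
  have fine: "\<exists>N. \<forall>n\<ge>N. \<forall>i<Suc n. uniform_div a b n (Suc i) - uniform_div a b n i < \<delta>" if "\<delta> > 0" for \<delta>
    using uniform_div_fine[OF that, of b a] unfolding eventually_sequentially div(2) by blast
  have "\<exists>l. lc_limit (U g) l" if g: "g \<in> CAB a b" for g
  proof (rule complete_seq)
    fix p and e :: real assume "p \<in> P" "e > 0"
    then obtain \<delta> where d: "\<delta> > 0" "\<And>n t s m u r. tagged_div a b n t s \<Longrightarrow> \<forall>i<n. t (Suc i) - t i < \<delta> \<Longrightarrow>
        tagged_div a b m u r \<Longrightarrow> \<forall>i<m. u (Suc i) - u i < \<delta> \<Longrightarrow> p (rs_sum sm g x n t s - rs_sum sm g x m u r) < e"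
      using rs_sum_cauchy[OF x _ g] by blast
    obtain N where "\<forall>n\<ge>N. \<forall>i<Suc n. uniform_div a b n (Suc i) - uniform_div a b n i < \<delta>"
      using fine[OF d(1)] by blast
    then show "\<exists>N. \<forall>m\<ge>N. \<forall>n\<ge>N. p (U g m - U g n) < e"
      unfolding U_def by (intro exI[of _ N] allI impI d(2) div(1)) auto
  qed
  then obtain T where T: "\<And>g. g \<in> CAB a b \<Longrightarrow> lc_limit (U g) (T g)" by metis
  have "has_rs_integral sm P a b g x (T g)" if g: "g \<in> CAB a b" for g
  proof (rule has_rs_integralI)
    fix p and e :: real assume p: "p \<in> P" and e: "e > 0"
    then obtain \<delta> where d: "\<delta> > 0" "\<And>n t s m u r. tagged_div a b n t s \<Longrightarrow> \<forall>i<n. t (Suc i) - t i < \<delta> \<Longrightarrow>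
        tagged_div a b m u r \<Longrightarrow> \<forall>i<m. u (Suc i) - u i < \<delta> \<Longrightarrow> p (rs_sum sm g x n t s - rs_sum sm g x m u r) < e / 2"
      using rs_sum_cauchy[OF x p g, of "e / 2"] by (metis half_gt_zero)
    obtain N where N: "\<forall>n\<ge>N. \<forall>i<Suc n. uniform_div a b n (Suc i) - uniform_div a b n i < \<delta>"
      using fine[OF d(1)] by blast
    have "(\<lambda>n. p (U g n - T g)) \<longlonglongrightarrow> 0" using T[OF g] p by (simp add: lc_limit_def)
    then have "\<forall>\<^sub>F n in sequentially. p (U g n - T g) < e / 2"
      using e by (intro order_tendstoD) auto
    then obtain N' where N': "\<And>n. n \<ge> N' \<Longrightarrow> p (U g n - T g) < e / 2"
      by (auto simp: eventually_sequentially)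
    define m where "m = max N N'"
    have "p (rs_sum sm g x n t s - T g) < e"
      if "tagged_div a b n t s" "\<forall>i<n. t (Suc i) - t i < \<delta>" for n t s
    proof -
      have "p (rs_sum sm g x n t s - U g m) < e / 2"
        unfolding U_def using N by (intro d(2) div(1) that) (simp add: m_def)
      moreover have "p (U g m - T g) < e / 2" by (intro N') (simp add: m_def)
      ultimately show ?thesis
        using seminorm_diff_trans[OF seminorm_P[OF p], of "rs_sum sm g x n t s" "T g" "U g m"] by simp
    qed
    then show "\<exists>\<delta>>0. \<forall>n t s. tagged_div a b n t s \<and> (\<forall>i<n. t (Suc i) - t i < \<delta>)
        \<longrightarrow> p (rs_sum sm g x n t s - T g) < e"
      using d(1) by blast
  qed
  moreover have "weakly_compact_linear sm P a b T"
    unfolding weakly_compact_linear_def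
  proof (intro conjI ballI allI)
    fix g h assume gh: "g \<in> CAB a b" "h \<in> CAB a b"
    have "U (\<lambda>t. g t + h t) = (\<lambda>n. U g n + U h n)"
      by (simp add: fun_eq_iff U_def rs_sum_def scale_left_distrib sum.distrib)
    then show "T (\<lambda>t. g t + h t) = T g + T h"
      using lc_limit_unique[OF T[OF CAB_add[OF gh]]] lc_limit_add[OF T[OF gh(1)] T[OF gh(2)]] by simp
  next
    fix c g assume g: "g \<in> CAB a b"
    have "U (\<lambda>t. c * g t) = (\<lambda>n. sm c (U g n))"
      by (simp add: fun_eq_iff U_def rs_sum_def scale_sum_right del: sum.lessThan_Suc)
    then show "T (\<lambda>t. c * g t) = sm c (T g)"
      using lc_limit_unique[OF T[OF CAB_scale[OF g]]] lc_limit_scale[OF T[OF g]] by simp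
  next
    obtain K where K: "compactin W K" "\<And>N w c. \<forall>k<N. w k \<le> w (Suc k) \<Longrightarrow> a \<le> w 0 \<Longrightarrow> w N \<le> b \<Longrightarrow>
        \<forall>k<N. cmod (c k) \<le> 1 \<Longrightarrow> (\<Sum>k<N. sm (c k) (x (w (Suc k)) - x (w k))) \<in> K"
      using weakly_compact_increment_sums[OF x] by blast
    \<comment> \<open>All coefficients of the approximating sums have modulus at most 1, so the sums
      lie in \<open>K\<close>, and \<open>K\<close> is weakly closed.\<close>
    have "T g \<in> K" if g: "g \<in> CAB a b" "supnorm a b g < 1" for g
    proof (rule lc_limit_closedin[OF T[OF g(1)] compactin_weak_imp_closedin[OF K(1)]])
      fix n
      have "\<forall>k<Suc n. cmod (g (uniform_div a b n (Suc k))) \<le> 1"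
      proof (intro allI impI)
        fix k assume "k < Suc n"
        from tagged_div_bounds[OF div(1) this] have "uniform_div a b n (Suc k) \<in> {a..b}" by simp
        from CAB_norm_le_supnorm[OF g(1) this] g(2)
        show "cmod (g (uniform_div a b n (Suc k))) \<le> 1" by simp
      qed
      then show "U g n \<in> K"
        unfolding U_def rs_sum_def using div(1)[of n] by (intro K(2)) (auto simp: tagged_div_def)
    qed
    then show "\<exists>r>0. \<exists>K. compactin W K \<and> T ` {g \<in> CAB a b. supnorm a b g < r} \<subseteq> K"
      using K(1) by (intro exI[of _ 1]) auto
  qed
  ultimately show ?thesis by blast
qed

end

section \<open>From weakly compact maps to semivariation\<close>

text \<open>The closed sets that eventually contain the sequence have the finite intersection
  property. Closed sets replace convergent subsequences, which need not exist in a product over all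
  real \<open>t\<close>.\<close>

lemma compact_space_cluster_point:
  assumes X: "compact_space X" and f: "\<And>n::nat. f n \<in> topspace X"
  shows "\<exists>y\<in>topspace X. \<forall>C. closedin X C \<longrightarrow> (\<forall>\<^sub>F n in sequentially. f n \<in> C) \<longrightarrow> y \<in> C"
proof -
  define F where "F = {C. closedin X C \<and> (\<forall>\<^sub>F n in sequentially. f n \<in> C)}"
  have "\<Inter>G \<noteq> {}" if "finite G" "G \<subseteq> F" for G
  proof -
    have "\<forall>\<^sub>F n in sequentially. \<forall>C\<in>G. f n \<in> C"
      using that by (intro eventually_ball_finite) (auto simp: F_def)
    then obtain n where "\<forall>C\<in>G. f n \<in> C"
      using eventually_happens'[OF sequentially_bot] by blast
    then show ?thesis by blast
  qed
  moreover have "\<forall>C\<in>F. closedin X C" by (simp add: F_def)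
  ultimately have "\<Inter>F \<noteq> {}"
    using X[unfolded compact_space_fip, THEN spec, of F] by simp
  then obtain y where y: "\<And>C. C \<in> F \<Longrightarrow> y \<in> C" by blast
  have "topspace X \<in> F" using f by (simp add: F_def)
  then show ?thesis using y by (auto simp: F_def)
qed

text \<open>The sum is the total rise of \<open>v\<close> minus the skipped rises
  \<open>v (2*i+2) - v (2*i+1)\<close>, which are nonnegative.\<close>

lemma alternating_sum_bounds:
  fixes v :: "nat \<Rightarrow> real"
  assumes "\<And>i. i < 2*m+1 \<Longrightarrow> v i \<le> v (Suc i)"
  shows "0 \<le> (\<Sum>i<Suc m. v (2*i+1) - v (2*i))" "(\<Sum>i<Suc m. v (2*i+1) - v (2*i)) \<le> v (2*m+1) - v 0"
proof -
  show "0 \<le> (\<Sum>i<Suc m. v (2*i+1) - v (2*i))"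
    using assms by (intro sum_nonneg) auto
  show "(\<Sum>i<Suc m. v (2*i+1) - v (2*i)) \<le> v (2*m+1) - v 0"
    using assms
  proof (induction m)
    case (Suc m)
    have "v (2*m+1) \<le> v (2*m+2)" using Suc.prems[of "2*m+1"] by simp
    moreover have "(\<Sum>i<Suc m. v (2*i+1) - v (2*i)) \<le> v (2*m+1) - v 0"
      using Suc.prems by (intro Suc.IH) auto
    ultimately show ?case by simp
  qed simp
qed

text \<open>A continuous approximation from below of the indicator function of \<open>[a, t)\<close>, or of
  \<open>[a, b]\<close> if \<open>t = b\<close>: moving the endpoint to \<open>b + 1\<close> makes the value at \<open>b\<close> count.\<close>

definition ramp :: "real \<Rightarrow> nat \<Rightarrow> real \<Rightarrow> real \<Rightarrow> real" where
  "ramp b n t s = clamp_to 0 1 (real (Suc n) * ((if b \<le> t then b + 1 else t) - s))"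

lemma ramp_bounds: "0 \<le> ramp b n t s" "ramp b n t s \<le> 1"
  by (auto simp: ramp_def clamp_to_def)

lemma ramp_mono: "t \<le> t' \<Longrightarrow> ramp b n t s \<le> ramp b n t' s"
  unfolding ramp_def by (intro clamp_to_mono mult_left_mono) auto

lemma ramp_left:
  assumes "t \<le> s" "t < b" shows "ramp b n t s = 0"
proof -
  have "real (Suc n) * (t - s) \<le> 0" using assms(1) by (intro mult_nonneg_nonpos) auto
  then show ?thesis using assms(2) by (simp add: ramp_def clamp_to_def)
qed

lemma ramp_right:
  assumes "s \<le> b" shows "ramp b n b s = 1"
proof -
  have "1 * 1 \<le> real (Suc n) * (b + 1 - s)" using assms by (intro mult_mono) auto
  then show ?thesis by (simp add: ramp_def clamp_to_def)
qed

text \<open>Right of \<open>t'\<close> both ramps vanish, and left of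
  \<open>t - 1 / real (Suc n)\<close> both are 1.\<close>

lemma ramp_neq_imp_near:
  assumes "ramp b n t s \<noteq> ramp b n t' s" "t \<le> t'" "s \<le> b"
  shows "s \<le> t'" "t - 1 / real (Suc n) \<le> s"
proof -
  show "s \<le> t'"
  proof (rule ccontr)
    assume *: "\<not> s \<le> t'"
    have "ramp b n u s = 0" if "u < s" for u
      using that assms(3) by (intro ramp_left) auto
    then show False using assms * by simp
  qed
  show "t - 1 / real (Suc n) \<le> s"
  proof (rule ccontr)
    assume *: "\<not> t - 1 / real (Suc n) \<le> s"
    have "ramp b n u s = 1" if "u - 1 / real (Suc n) > s" for u
    proof -
      have "1 / real (Suc n) \<le> (if b \<le> u then b + 1 else u) - s"
      proof (cases "b \<le> u")
        case True
        have "1 / real (Suc n) \<le> 1" by simp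
        then have "1 / real (Suc n) \<le> b + 1 - s" using assms(3) by linarith
        then show ?thesis using True by simp
      qed (use that in simp)
      then have "1 \<le> real (Suc n) * ((if b \<le> u then b + 1 else u) - s)"
        by (simp add: field_simps)
      then show ?thesis by (simp add: ramp_def clamp_to_def)
    qed
    then show False using assms * by simp
  qed
qed

text \<open>The value 0 outside \<open>[a,b]\<close> is the normalisation by which
  \<open>CAB\<close> identifies functions on the interval.\<close>

definition cramp :: "real \<Rightarrow> real \<Rightarrow> nat \<Rightarrow> real \<Rightarrow> real \<Rightarrow> complex" where
  "cramp a b n t s = (if s \<in> {a..b} then of_real (ramp b n t s) else 0)"

lemma cramp_CAB: "cramp a b n t \<in> CAB a b"
proof -
  have "continuous_on {a..b} (\<lambda>s. complex_of_real (ramp b n t s))"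
    unfolding ramp_def clamp_to_def by (intro continuous_intros)
  then have "continuous_on {a..b} (cramp a b n t)"
    by (rule continuous_on_eq) (simp add: cramp_def)
  then show ?thesis by (simp add: CAB_def cramp_def)
qed

lemma CAB_diff: "g \<in> CAB a b \<Longrightarrow> h \<in> CAB a b \<Longrightarrow> (\<lambda>t. g t - h t) \<in> CAB a b"
  by (auto simp: CAB_def intro: continuous_intros)

lemma CAB_lincomb: "(\<And>i. i \<in> A \<Longrightarrow> g i \<in> CAB a b) \<Longrightarrow> (\<lambda>t. \<Sum>i\<in>A. c i * g i t) \<in> CAB a b"
  by (auto simp: CAB_def intro!: continuous_intros)

context complete_lcs
begin

text \<open>\<open>y t\<close> stands in for the value of \<open>T\<close> at the indicator function
  of \<open>[a,t)\<close>. Riemann--Stieltjes sums against \<open>y\<close> then correspond to step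
  functions close to \<open>g\<close>, approximated by ramps.\<close>

theorem weakly_compact_imp_semivariation:
  assumes T: "weakly_compact_linear sm P a b T" and "a < b"
  shows "\<exists>y. weakly_compact_semivariation sm P y a b \<and>
     (\<forall>g\<in>CAB a b. has_rs_integral sm P a b g y (T g))"
proof -
  obtain r K where r: "r > 0" and K: "compactin W K" "T ` {g\<in>CAB a b. supnorm a b g < r} \<subseteq> K"
    using T unfolding weakly_compact_linear_def by blast
  have Tadd: "T (\<lambda>t. g t + h t) = T g + T h" if "g \<in> CAB a b" "h \<in> CAB a b" for g h
    using T that unfolding weakly_compact_linear_def by blast
  have Tscale: "T (\<lambda>t. c * g t) = sm c (T g)" if "g \<in> CAB a b" for g c
    using T that unfolding weakly_compact_linear_def by blast
  have Tdiff: "T (\<lambda>t. g t - h t) = T g - T h" if "g \<in> CAB a b" "h \<in> CAB a b" for g h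
    using Tadd[OF that(1) CAB_scale[OF that(2), of "-1"]] Tscale[OF that(2), of "-1"] by simp
  have zero: "(\<lambda>t. 0) \<in> CAB a b" by (simp add: CAB_def)
  have Tzero: "T (\<lambda>t. 0) = 0" using Tscale[OF zero, of 0] by simp
  have Tlincomb: "T (\<lambda>t. \<Sum>i<n. c i * g i t) = (\<Sum>i<n. sm (c i) (T (g i)))"
    if "\<And>i. g i \<in> CAB a b" for n c and g :: "nat \<Rightarrow> real \<Rightarrow> complex"
  proof (induction n)
    case (Suc n)
    have "T (\<lambda>t. (\<Sum>i<n. c i * g i t) + c n * g n t) = T (\<lambda>t. \<Sum>i<n. c i * g i t) + T (\<lambda>t. c n * g n t)"
      using that by (intro Tadd CAB_lincomb CAB_scale)
    then show ?case using Suc Tscale[OF that] by simp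
  qed (simp add: Tzero)

  \<comment> \<open>If \<open>g\<close> is bounded by 1, then \<open>(r/2) g\<close> has sup norm at
    most \<open>r/2 < r\<close>; the factor \<open>2 / r\<close> undoes this scaling.\<close>
  define L where "L = sm (of_real (2 / r)) ` K"
  have L: "compactin W L" unfolding L_def by (rule compactin_weak_scale[OF K(1)])
  have closedL: "closedin W L" by (rule compactin_weak_imp_closedin[OF L])
  have TL: "T g \<in> L" if g: "g \<in> CAB a b" and le: "\<And>t. t \<in> {a..b} \<Longrightarrow> cmod (g t) \<le> 1" for g
  proof -
    have "supnorm a b (\<lambda>t. of_real (r / 2) * g t) \<le> r / 2"
      unfolding supnorm_def using r \<open>a < b\<close> le
      by (intro cSUP_least) (auto simp: norm_mult)
    then have "T (\<lambda>t. of_real (r / 2) * g t) \<in> K"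
      using K(2) CAB_scale[OF g] r by fastforce
    then have "sm (of_real (2 / r)) (sm (of_real (r / 2)) (T g)) \<in> L"
      unfolding L_def Tscale[OF g] by (rule imageI)
    then show ?thesis using r by (simp flip: of_real_mult)
  qed

  define X where "X = product_topology (\<lambda>t::real. subtopology W L) UNIV"
  define h where "h n t = T (cramp a b n t)" for n t
  have "compact_space X"
    unfolding X_def using L by (simp add: compact_space_product_topology compact_space_subtopology)
  moreover have "h n \<in> topspace X" for n
    using ramp_bounds by (auto simp: X_def h_def cramp_def intro!: TL cramp_CAB)
  ultimately obtain y where y: "y \<in> topspace X"
      "\<And>C. closedin X C \<Longrightarrow> \<forall>\<^sub>F n in sequentially. h n \<in> C \<Longrightarrow> y \<in> C"
    using compact_space_cluster_point by blast
  have proj: "continuous_map X W (\<lambda>z. z t)" for t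
    using continuous_map_product_projection[of t UNIV "\<lambda>t. subtopology W L"]
    by (simp add: X_def continuous_map_in_subtopology)
  \<comment> \<open>A finite combination of coordinates is weakly continuous on \<open>X\<close>.
    Hence a weakly closed condition that holds eventually for the ramps also holds for the cluster
    point \<open>y\<close>.\<close>
  have transfer: "(\<Sum>i<n. sm (c i) (y (v i) - y (u i))) \<in> C"
    if C: "closedin W C"
      and ev: "\<forall>\<^sub>F N in sequentially. T (\<lambda>s. \<Sum>i<n. c i * (cramp a b N (v i) s - cramp a b N (u i) s)) \<in> C"
    for n :: nat and c v u C
  proof -
    define \<Phi> where "\<Phi> z = (\<Sum>i<n. sm (c i) (z (v i) - z (u i)))" for z
    have "continuous_map X W \<Phi>"
      unfolding \<Phi>_def
      by (intro continuous_map_weak_sum continuous_map_weak_scale continuous_map_weak_diff proj) simp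
    then have "closedin X {z \<in> topspace X. \<Phi> z \<in> C}"
      using C by (rule closedin_continuous_map_preimage)
    moreover have "T (\<lambda>s. \<Sum>i<n. c i * (cramp a b N (v i) s - cramp a b N (u i) s)) = \<Phi> (h N)" for N
      unfolding \<Phi>_def h_def
      by (subst Tlincomb) (simp_all add: CAB_diff Tdiff cramp_CAB)
    ultimately have "y \<in> {z \<in> topspace X. \<Phi> z \<in> C}"
      using ev \<open>\<And>n. h n \<in> topspace X\<close> by (intro y(2)) auto
    then show ?thesis by (simp add: \<Phi>_def)
  qed

  have "Eset y a b \<subseteq> L"
  proof
    fix z assume "z \<in> Eset y a b"
    then obtain n t where nt: "z = (\<Sum>i<n. y (t (2*i+1)) - y (t (2*i)))" "n \<ge> 1"
        "\<forall>i<2*n-1. t i < t (Suc i)"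
      unfolding Eset_def by blast
    then obtain m where m: "n = Suc m" by (cases n) auto
    have "T (\<lambda>s. \<Sum>i<n. 1 * (cramp a b N (t (2*i+1)) s - cramp a b N (t (2*i)) s)) \<in> L" for N
    proof (rule TL)
      show "(\<lambda>s. \<Sum>i<n. 1 * (cramp a b N (t (2*i+1)) s - cramp a b N (t (2*i)) s)) \<in> CAB a b"
        by (intro CAB_lincomb CAB_diff cramp_CAB)
      fix s assume s: "s \<in> {a..b}"
      \<comment> \<open>For fixed \<open>s\<close> the ramps increase with \<open>t\<close>, so the
        alternating sum lies between 0 and the total rise, which is at most 1.\<close>
      define v where "v i = ramp b N (t i) s" for i
      have "v i \<le> v (Suc i)" if "i < 2*m+1" for i
        unfolding v_def using nt(3) m that by (intro ramp_mono) (auto intro: less_imp_le)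
      then have "0 \<le> (\<Sum>i<n. v (2*i+1) - v (2*i))" "(\<Sum>i<n. v (2*i+1) - v (2*i)) \<le> v (2*m+1) - v 0"
        using alternating_sum_bounds[of m v] unfolding m by blast+
      moreover have "v (2*m+1) - v 0 \<le> 1"
        using ramp_bounds[of b N] unfolding v_def by (smt (verit))
      moreover have "(\<Sum>i<n. 1 * (cramp a b N (t (2*i+1)) s - cramp a b N (t (2*i)) s)) =
          of_real (\<Sum>i<n. v (2*i+1) - v (2*i))"
        using s by (simp add: cramp_def v_def)
      ultimately show "cmod (\<Sum>i<n. 1 * (cramp a b N (t (2*i+1)) s - cramp a b N (t (2*i)) s)) \<le> 1"
        by (simp only: norm_of_real)
    qed
    then show "z \<in> L"
      using transfer[OF closedL, where n = n and c = "\<lambda>_. 1" and v = "\<lambda>i. t (2*i+1)" and u = "\<lambda>i. t (2*i)"] nt(1) by simp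
  qed
  then have "W closure_of Eset y a b \<subseteq> L" using closedL by (rule closure_of_minimal)
  then have "weakly_compact_semivariation sm P y a b"
    unfolding weakly_compact_semivariation_def using L by (meson closed_compactin closedin_closure_of)
  moreover have "has_rs_integral sm P a b g y (T g)" if g: "g \<in> CAB a b" for g
  proof (rule has_rs_integralI)
    fix p and e :: real assume p: "p \<in> P" and e: "e > 0"
    note sem = seminorm_P[OF p]
    obtain B where B: "\<And>z. z \<in> L \<Longrightarrow> p z \<le> B"
      using weakly_compact_imp_bounded[OF p L] by blast
    have "T (\<lambda>t. 0) \<in> L" by (intro TL zero) simp
    then have B0: "B \<ge> 0" using B seminorm_nonneg[OF sem] order_trans by blast
    define M where "M = e / (B + 1)"
    have M: "M > 0" "M * B < e" using e B0 by (auto simp: M_def field_simps)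
    have pT: "p (T f) \<le> M * B" if f: "f \<in> CAB a b" and le: "\<And>t. t \<in> {a..b} \<Longrightarrow> cmod (f t) \<le> M" for f
    proof -
      have "T (\<lambda>t. of_real (1 / M) * f t) \<in> L"
        using M le by (intro TL CAB_scale f) (simp add: norm_divide)
      then have "p (sm (of_real (1 / M)) (T f)) \<le> B"
        using B Tscale[OF f] by metis
      then show ?thesis using M by (simp add: seminorm_scale[OF sem] norm_divide field_simps)
    qed
    obtain d where d: "d > 0" "\<And>s t. s \<in> {a..b} \<Longrightarrow> t \<in> {a..b} \<Longrightarrow> \<bar>s - t\<bar> < d \<Longrightarrow> cmod (g s - g t) \<le> M"
      using CAB_uniformly_continuous[OF g M(1)] by blast
    have "p (rs_sum sm g y n t \<tau> - T g) < e"
      if t: "tagged_div a b n t \<tau>" and mesh: "\<forall>i<n. t (Suc i) - t i < d / 2" for n t \<tau>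
    proof -
      define G where "G N s = (\<Sum>i<n. g (\<tau> (Suc i)) * (cramp a b N (t (Suc i)) s - cramp a b N (t i) s))" for N s
      have G: "G N \<in> CAB a b" for N
        unfolding G_def by (intro CAB_lincomb CAB_diff cramp_CAB)
      have close: "cmod (G N s - g s) \<le> M" if N: "1 / real (Suc N) < d / 2" and s: "s \<in> {a..b}" for N s
      proof -
        \<comment> \<open>These weights form a partition of unity on \<open>[a,b]\<close>: they are
          nonnegative and telescope to the ramp at \<open>b\<close>, which is 1, minus the ramp at
          \<open>a\<close>, which is 0.\<close>
        define D where "D i = ramp b N (t (Suc i)) s - ramp b N (t i) s" for i
        have D0: "D i \<ge> 0" if "i < n" for i
          using tagged_div_bounds(3)[OF t that] by (simp add: D_def ramp_mono)
        have D1: "(\<Sum>i<n. D i) = 1"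
          using sum_lessThan_telescope[of "\<lambda>i. ramp b N (t i) s" n] t s \<open>a < b\<close>
          by (simp add: D_def tagged_div_def ramp_left ramp_right)
        have "G N s - g s = (\<Sum>i<n. g (\<tau> (Suc i)) * of_real (D i)) - g s * of_real (\<Sum>i<n. D i)"
          using s by (simp add: G_def D1) (simp add: cramp_def D_def)
        also have "\<dots> = (\<Sum>i<n. (g (\<tau> (Suc i)) - g s) * of_real (D i))"
          by (simp add: sum_distrib_left left_diff_distrib sum_subtractf)
        also have "cmod \<dots> \<le> (\<Sum>i<n. M * D i)"
        proof (rule sum_norm_le)
          fix i assume "i \<in> {..<n}"
          then have i: "i < n" by simp
          show "cmod ((g (\<tau> (Suc i)) - g s) * of_real (D i)) \<le> M * D i"
          proof (cases "D i = 0")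
            case False
            note b = tagged_div_bounds[OF t i]
            \<comment> \<open>A nonzero weight at \<open>s\<close> puts \<open>s\<close> within
              \<open>1 / real (Suc N) < d / 2\<close> of the \<open>i\<close>-th interval, whose
              length is below \<open>d / 2\<close>; so \<open>s\<close> is within \<open>d\<close>
              of the tag.\<close>
            have "ramp b N (t i) s \<noteq> ramp b N (t (Suc i)) s" using False by (simp add: D_def)
            then have "s \<le> t (Suc i)" "t i - 1 / real (Suc N) \<le> s"
              using ramp_neq_imp_near[of b N "t i" s "t (Suc i)"] b s by auto
            moreover have "t (Suc i) - t i < d / 2" using mesh i by blast
            ultimately have "\<tau> (Suc i) - s < d" "s - \<tau> (Suc i) < d"
              using N b d(1) by linarith+
            then have "cmod (g (\<tau> (Suc i)) - g s) \<le> M"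
              using b s by (intro d(2)) auto
            then show ?thesis
              using D0[OF i] by (simp add: norm_mult mult_right_mono)
          qed simp
        qed
        also have "\<dots> = M" by (simp add: D1 flip: sum_distrib_left)
        finally show ?thesis .
      qed
      \<comment> \<open>The bound is put in the form of a weakly closed seminorm ball, so that
        \<open>transfer\<close> carries it from the ramps to the sum against
        \<open>y\<close>.\<close>
      have "T (G N) \<in> {z. p (z - T g) \<le> M * B}" if N: "1 / real (Suc N) < d / 2" for N
        using pT[OF CAB_diff[OF G g] close[OF N]] Tdiff[OF G g] by simp
      moreover have "\<forall>\<^sub>F N in sequentially. 1 / real (Suc N) < d / 2"
        using uniform_div_fine[of "d / 2" 1 0] d(1) by simp
      ultimately have "\<forall>\<^sub>F N in sequentially. T (G N) \<in> {z. p (z - T g) \<le> M * B}"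
        by (auto elim: eventually_mono)
      then have "rs_sum sm g y n t \<tau> \<in> {z. p (z - T g) \<le> M * B}"
        unfolding rs_sum_def G_def by (rule transfer[OF closedin_weak_seminorm_ball[OF p]])
      then show ?thesis using M(2) by simp
    qed
    then show "\<exists>\<delta>>0. \<forall>n t s. tagged_div a b n t s \<and> (\<forall>i<n. t (Suc i) - t i < \<delta>)
        \<longrightarrow> p (rs_sum sm g y n t s - T g) < e"
      using d(1) by (intro exI[of _ "d / 2"]) auto
  qed
  ultimately show ?thesis by blast
qed

end

theorem theorem6:
  fixes sm :: "complex \<Rightarrow> 'x::ab_group_add \<Rightarrow> 'x"
    and P :: "('x \<Rightarrow> real) set"
    and a b :: real
  assumes "complete_hausdorff_lcs sm P"
    and "a < b"
  shows "(\<forall>x. weakly_compact_semivariation sm P x a b \<longrightarrow>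
            (\<exists>T. (\<forall>g\<in>CAB a b. has_rs_integral sm P a b g x (T g)) \<and>
                 weakly_compact_linear sm P a b T)) \<and>
         (\<forall>T. weakly_compact_linear sm P a b T \<longrightarrow>
            (\<exists>y. weakly_compact_semivariation sm P y a b \<and>
                 (\<forall>g\<in>CAB a b. has_rs_integral sm P a b g y (T g))))"
proof -
  interpret complete_lcs sm P by unfold_locales (rule assms(1))
  show ?thesis
    using semivariation_imp_weakly_compact weakly_compact_imp_semivariation assms(2) by blast
qed

end
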